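(* Consider the quantized ARX setting described in the context and suppose Assumptions (A1)–(A5) hold. Let $c>0$ be the constant of (A3) and $c_1>0$ the constant of (A5). Let $c_3>0$ be a constant such that, almost surely, $\lambda^{(p_0,q^* )}_{max}(n)\le c_3(n+1)$ for all sufficiently large $n$, and let $\gamma$ be a constant such that, almost surely, $\|\tilde\theta_n(p)\|\le\gamma$ for all sufficiently large $n$ and every $0\le p\le p_0$. Let $\alpha_1>0$ and $0<\alpha_2<1$, and let the sequence $(l_n)$ satisfy $$\bigl[5(1+p^*c)\varepsilon+\alpha_1\bigr]n\;\le\; l_n\;\le\;\frac{\alpha_2}{p^*}\Bigl[a_{p_0}^2c_1-2\gamma\sqrt{c_3(1+p^*c)\varepsilon}-3(1+p^*c)\varepsilon\Bigr]n .$$ Define $L_n(p,q):=\sigma_n(p,q)+l_n\,(p+q)$ and $\hat p_n:=\mathrm{argmin}_{0\le p\le p^*}L_n(p,q^* )$. Then $\hat p_n\to p_0$ almost surely as $n\to\infty$.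
   Context: System: $A(z)y_{n+1}=B(z)u_n+w_{n+1}$, $n\ge0$, where $z$ is the backward shift operator, $A(z)=1+a_1z+\dots+a_{p_0}z^{p_0}$ ($p_0\ge0$), $B(z)=b_1+b_2z+\dots+b_{q_0}z^{q_0-1}$ ($q_0\ge1$), $a_{p_0}\ne0$, $b_{q_0}\ne0$; i.e. $y_{n+1}=-a_1y_n-\dots-a_{p_0}y_{n-p_0+1}+b_1u_n+\dots+b_{q_0}u_{n-q_0+1}+w_{n+1}$. The parameters and the orders $p_0,q_0$ are unknown. The noise $\{w_n\}$ is i.i.d. with $w_n\sim N(0,1)$, and $y_n=u_n=w_n=0$ for $n<0$. Given a quantization step $\varepsilon>0$, only the quantized outputs $s_n=\varepsilon\lfloor y_n/\varepsilon+1/2\rfloor$ are observed. For integers $p,q\ge0$ define $\psi_i(p,q)=[s_i,\dots,s_{i-p+1},u_i,\dots,u_{i-q+1}]^\top$, where $s_i=u_i=0$ when $i\le0$, and $P_{n+1}(p,q)=\bigl(I+\sum_{i=0}^n\psi_i(p,q)\psi_i(p,q)^\top\bigr)^{-1}$; $\lambda^{(p,q)}_{min}(n)$ and $\lambda^{(p,q)}_{max}(n)$ denote the smallest and largest eigenvalues of $P^{-1}_{n+1}(p,q)$. Define $\bar\theta(p,q)=[-a_1,\dots,-a_p,b_1,\dots,b_q]^\top$ with the convention $a_i=0$ for $i>p_0$, $b_j=0$ for $j>q_0$. The least squares estimate is $\theta_n(p,q)=P_n(p,q)\sum_{i=0}^{n-1}\psi_i(p,q)s_{i+1}$, and $\sigma_n(p,q)=\sum_{i=0}^{n-1}(s_{i+1}-\theta_n(p,q)^\top\psi_i(p,q))^2$.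 For $0\le p\le p_0$, writing $\theta_n(p,q^* )=[-a_{1n}(p),\dots,-a_{pn}(p),b_{1n}(p),\dots,b_{q^*n}(p)]^\top$, set $\hat\theta_n(p)=[-a_{1n}(p),\dots,-a_{pn}(p),0,\dots,0,b_{1n}(p),\dots,b_{q^*n}(p)]^\top$ (with $p_0-p$ zeros) and $\tilde\theta_n(p)=\bar\theta(p_0,q^* )-\hat\theta_n(p)$. Assumptions: (A1) $\{u_i\}$ is i.i.d., uniformly distributed on $[-\delta,\delta]$, $\delta>0$. (A2) $A(z)\ne0$ for all $|z|\le1$. (A3) There is $c>0$ with $|a_i|\le c$, $|b_j|\le c$ for all $i\le p_0$, $j\le q_0$, and $\varepsilon<\frac{1}{2(1+p_0c)}$. (A4) $(p_0,q_0)\in M=\{(p,q):0\le p\le p^*,1\le q\le q^*\}$ for known integers $p^*,q^*>0$. (A5) There is $c_1>0$ such that for all $0\le p\le p^*$, almost surely $\lambda^{(p,q^* )}_{min}(n)\ge c_1(n+1)$ for all sufficiently large $n$.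
   Formalization: The input sequence {u_n} is additionally assumed independent of the noise {w_n} (without this the claim can fail, e.g. if u_n is a function of w_{n+2}), and the unspecified initial output is taken to be y_0 = w_0, i.e. the recursion is also applied at n = -1. *)

theory Defs
  imports "HOL-Probability.Probability" "Jordan_Normal_Form.Char_Poly"
    "Jordan_Normal_Form.Gauss_Jordan_Elimination"
begin

definition quant :: "real \<Rightarrow> real \<Rightarrow> real" where
  "quant eps x = eps * real_of_int \<lfloor>x / eps + 1/2\<rfloor>"

definition neg0 :: "(nat \<Rightarrow> real) \<Rightarrow> int \<Rightarrow> real" where
  "neg0 x k = (if k < 0 then 0 else x (nat k))"

definition nonpos0 :: "(nat \<Rightarrow> real) \<Rightarrow> int \<Rightarrow> real" where
  "nonpos0 x k = (if k \<le> 0 then 0 else x (nat k))"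

definition psi :: "(nat \<Rightarrow> real) \<Rightarrow> (nat \<Rightarrow> real) \<Rightarrow> nat \<Rightarrow> nat \<Rightarrow> nat \<Rightarrow> real vec" where
  "psi s u p q i = vec (p + q) (\<lambda>k. if k < p then nonpos0 s (int i - int k)
                                   else nonpos0 u (int i - int (k - p)))"

definition Pinv :: "(nat \<Rightarrow> real) \<Rightarrow> (nat \<Rightarrow> real) \<Rightarrow> nat \<Rightarrow> nat \<Rightarrow> nat \<Rightarrow> real mat" where
  "Pinv s u p q n = mat (p + q) (p + q) (\<lambda>(j, k). (if j = k then 1 else 0) +
      (\<Sum>i<n. psi s u p q i $ j * psi s u p q i $ k))"

definition Pmat :: "(nat \<Rightarrow> real) \<Rightarrow> (nat \<Rightarrow> real) \<Rightarrow> nat \<Rightarrow> nat \<Rightarrow> nat \<Rightarrow> real mat" where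
  "Pmat s u p q n = the (mat_inverse (Pinv s u p q n))"

definition lam_min :: "real mat \<Rightarrow> real" where
  "lam_min A = Min {k. eigenvalue A k}"

definition lam_max :: "real mat \<Rightarrow> real" where
  "lam_max A = Max {k. eigenvalue A k}"

definition lmin :: "(nat \<Rightarrow> real) \<Rightarrow> (nat \<Rightarrow> real) \<Rightarrow> nat \<Rightarrow> nat \<Rightarrow> nat \<Rightarrow> real" where
  "lmin s u p q n = lam_min (Pinv s u p q (Suc n))"

definition lmax :: "(nat \<Rightarrow> real) \<Rightarrow> (nat \<Rightarrow> real) \<Rightarrow> nat \<Rightarrow> nat \<Rightarrow> nat \<Rightarrow> real" where
  "lmax s u p q n = lam_max (Pinv s u p q (Suc n))"

definition theta_ls :: "(nat \<Rightarrow> real) \<Rightarrow> (nat \<Rightarrow> real) \<Rightarrow> nat \<Rightarrow> nat \<Rightarrow> nat \<Rightarrow> real vec" where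
  "theta_ls s u p q n = Pmat s u p q n *\<^sub>v
      vec (p + q) (\<lambda>j. \<Sum>i<n. psi s u p q i $ j * s (Suc i))"

definition sigma_ls :: "(nat \<Rightarrow> real) \<Rightarrow> (nat \<Rightarrow> real) \<Rightarrow> nat \<Rightarrow> nat \<Rightarrow> nat \<Rightarrow> real" where
  "sigma_ls s u p q n = (\<Sum>i<n. (s (Suc i) -
      (\<Sum>j<p + q. theta_ls s u p q n $ j * psi s u p q i $ j))\<^sup>2)"

definition Lcrit :: "(nat \<Rightarrow> real) \<Rightarrow> (nat \<Rightarrow> real) \<Rightarrow> (nat \<Rightarrow> real) \<Rightarrow> nat \<Rightarrow> nat \<Rightarrow> nat \<Rightarrow> real" where
  "Lcrit s u l p q n = sigma_ls s u p q n + l n * real (p + q)"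

definition phat :: "(nat \<Rightarrow> real) \<Rightarrow> (nat \<Rightarrow> real) \<Rightarrow> (nat \<Rightarrow> real) \<Rightarrow> nat \<Rightarrow> nat \<Rightarrow> nat \<Rightarrow> nat" where
  "phat s u l pstar qstar n =
     (LEAST p. p \<le> pstar \<and> (\<forall>p'\<le>pstar. Lcrit s u l p qstar n \<le> Lcrit s u l p' qstar n))"

definition theta_bar :: "(nat \<Rightarrow> real) \<Rightarrow> (nat \<Rightarrow> real) \<Rightarrow> nat \<Rightarrow> nat \<Rightarrow> real vec" where
  "theta_bar a b p q = vec (p + q) (\<lambda>k. if k < p then - a (Suc k) else b (Suc (k - p)))"

definition theta_hat :: "(nat \<Rightarrow> real) \<Rightarrow> (nat \<Rightarrow> real) \<Rightarrow> nat \<Rightarrow> nat \<Rightarrow> nat \<Rightarrow> nat \<Rightarrow> real vec" where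
  "theta_hat s u p0 qstar p n = vec (p0 + qstar) (\<lambda>k.
      if k < p then theta_ls s u p qstar n $ k
      else if k < p0 then 0
      else theta_ls s u p qstar n $ (p + (k - p0)))"

definition theta_tilde :: "(nat \<Rightarrow> real) \<Rightarrow> (nat \<Rightarrow> real) \<Rightarrow> (nat \<Rightarrow> real) \<Rightarrow> (nat \<Rightarrow> real)
    \<Rightarrow> nat \<Rightarrow> nat \<Rightarrow> nat \<Rightarrow> nat \<Rightarrow> real vec" where
  "theta_tilde a b s u p0 qstar p n = theta_bar a b p0 qstar - theta_hat s u p0 qstar p n"

definition vnorm :: "real vec \<Rightarrow> real" where
  "vnorm v = sqrt (\<Sum>j<dim_vec v. (v $ j)\<^sup>2)"

end

(* Write s_{i+1} = theta . psi_i + w_{i+1} + eta_{i+1}, where eta collects the quantization errors, so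
   that |eta| <= h = (1 + p0 c) eps / 2 apart from finitely many times. The parameter theta competes in
   the regularised least squares problem, hence sigma_n(p0) <= sum (w + eta)^2 + O(1). For p >= p0
   completing the square gives sigma_n(p) >= sum (w + eta)^2 - sum eta^2 - 2 (theta_n - theta) . sum psi w;
   for p < p0 the estimation error has a coordinate of size |a_{p0}|, so that (A5) adds a_{p0}^2 c1 n,
   while Cauchy-Schwarz limits the cross term with eta. The penalty l_n lies strictly between the two
   regimes.

   All that is needed from probability is that sum psi w = o(n) and sum w^2 = O(n). As psi_i is a
   function of the past and w_{i+1} is independent of it, both follow from a strong law for orthogonal
   sequences with bounded second moments; stability of A(z) bounds the second moments of the outputs. *)
theory Submission
  imports Defs "HOL-Complex_Analysis.Complex_Analysis" "Jordan_Normal_Form.Spectral_Radius"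
begin

unbundle no vec_syntax
unbundle no inner_syntax

section \<open>Rayleigh bounds for symmetric matrices\<close>

text \<open>The estimate depends on the whole noise path, so its product with the noise is not a sum
  of uncorrelated terms. It is split by coordinates instead: each coordinate of sum psi w is o(n) by
  itself, and the coefficients, which may depend on n and on the data, only have to stay bounded.
  For p < p0 this boundedness comes from \<gamma>; for p >= p0 it is derived from (A5). Write K for
  (1 + pstar c) eps. As h < 1/4 and 2h <= K, the quantization errors eventually have energy below K
  n. In overfitting, sigma_n drops by at most 2 K n + O(1), one K n being slack for the noise term,
  so a penalty of 5 K n leaves 3 K n. In underfitting it grows at least by the bracket of the upper
  bound for l_n with K in place of 3K, which leaves 2 K n. These remainders absorb the bounded ridge
  term |theta|^2. All almost sure statements are collected first; what follows from them is an
  argument about one realisation. Eigenvalues enter only through the quadratic form that they bound,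
  hence the Rayleigh bounds.\<close>

lemma scalar_prod_self_nonneg: "0 \<le> (x :: real vec) \<bullet> x"
  by (simp add: scalar_prod_def sum_nonneg)

lemma index_sq_le_scalar_prod:
  assumes "i < dim_vec (x :: real vec)"
  shows "(x $ i)\<^sup>2 \<le> x \<bullet> x"
proof -
  have "(x $ i)\<^sup>2 = sum (\<lambda>j. x $ j * x $ j) {i}" by (simp add: power2_eq_square)
  also have "\<dots> \<le> (\<Sum>j\<in>{0..<dim_vec x}. x $ j * x $ j)"
    using assms by (intro sum_mono2) auto
  finally show ?thesis by (simp add: scalar_prod_def)
qed

text \<open>Each product of two coordinates is at most \<open>x \<bullet> x\<close>, so the sum of
  the absolute entries serves; the added 1 makes the constant positive, so that one can divide by
  it.\<close>

lemma form_upper_bound: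
  fixes A :: "real mat"
  assumes A: "A \<in> carrier_mat N N"
  obtains K where "K > 0" "\<And>x. x \<in> carrier_vec N \<Longrightarrow> x \<bullet> (A *\<^sub>v x) \<le> K * (x \<bullet> x)"
proof
  let ?K = "1 + (\<Sum>i<N. \<Sum>j<N. \<bar>A $$ (i, j)\<bar>)"
  show "?K > 0" by (intro add_pos_nonneg sum_nonneg) auto
  fix x :: "real vec" assume x: "x \<in> carrier_vec N"
  have "x \<bullet> (A *\<^sub>v x) = (\<Sum>i<N. \<Sum>j<N. A $$ (i, j) * (x $ i * x $ j))"
    using A x by (auto simp: scalar_prod_def lessThan_atLeast0 sum_distrib_left mult_ac intro!: sum.cong)
  also have "\<dots> \<le> (\<Sum>i<N. \<Sum>j<N. \<bar>A $$ (i, j)\<bar> * (x \<bullet> x))"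
  proof (intro sum_mono)
    fix i j assume ij: "i \<in> {..<N}" "j \<in> {..<N}"
    have "\<bar>x $ i * x $ j\<bar> \<le> x \<bullet> x"
      using index_sq_le_scalar_prod[of i x] index_sq_le_scalar_prod[of j x] ij x
        sum_squares_bound[of "\<bar>x $ i\<bar>" "\<bar>x $ j\<bar>"] by (auto simp: abs_mult)
    then have "\<bar>A $$ (i, j)\<bar> * \<bar>x $ i * x $ j\<bar> \<le> \<bar>A $$ (i, j)\<bar> * (x \<bullet> x)"
      by (intro mult_left_mono) auto
    moreover have "A $$ (i, j) * (x $ i * x $ j) \<le> \<bar>A $$ (i, j)\<bar> * \<bar>x $ i * x $ j\<bar>"
      by (metis abs_ge_self abs_mult)
    ultimately show "A $$ (i, j) * (x $ i * x $ j) \<le> \<bar>A $$ (i, j)\<bar> * (x \<bullet> x)" by linarith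
  qed
  also have "\<dots> \<le> ?K * (x \<bullet> x)"
    using scalar_prod_self_nonneg[of x] by (simp add: sum_distrib_right distrib_right)
  finally show "x \<bullet> (A *\<^sub>v x) \<le> ?K * (x \<bullet> x)" .
qed

lemma symmetric_form_commute:
  fixes A :: "real mat"
  assumes A: "A \<in> carrier_mat N N" and sym: "transpose_mat A = A"
    and "x \<in> carrier_vec N" "z \<in> carrier_vec N"
  shows "x \<bullet> (A *\<^sub>v z) = z \<bullet> (A *\<^sub>v x)"
proof -
  have "(transpose_mat A *\<^sub>v x) \<bullet> z = x \<bullet> (A *\<^sub>v z)"
    using assms by (intro transpose_vec_mult_scalar[of _ N N]) auto
  then show ?thesis using assms comm_scalar_prod[of "A *\<^sub>v x" N z] by simp
qed

text \<open>The infimum \<open>m\<close> of the form over unit vectors is an eigenvalue: otherwise \<open>A - m\<close> is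
  positive semidefinite and invertible, hence bounded below by a positive constant.\<close>

lemma symmetric_ex_eigenvalue_le_form:
  fixes A :: "real mat"
  assumes A: "A \<in> carrier_mat N N" and sym: "transpose_mat A = A" and N: "0 < N"
  obtains k where "eigenvalue A k" "\<And>x. x \<in> carrier_vec N \<Longrightarrow> k * (x \<bullet> x) \<le> x \<bullet> (A *\<^sub>v x)"
proof -
  define S where "S = {x \<bullet> (A *\<^sub>v x) |x. x \<in> carrier_vec N \<and> x \<bullet> x = 1}"
  define m where "m = Inf S"
  have "unit_vec N 0 \<bullet> (A *\<^sub>v unit_vec N 0) \<in> S"
    using N unfolding S_def by (intro CollectI exI[of _ "unit_vec N 0"]) auto
  then have S_ne: "S \<noteq> {}" by auto
  \<comment> \<open>An upper bound for the form of \<open>- A\<close> is a lower bound for that of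
    \<open>A\<close>.\<close>
  obtain K where K: "\<And>x. x \<in> carrier_vec N \<Longrightarrow> x \<bullet> (- A *\<^sub>v x) \<le> K * (x \<bullet> x)"
    using form_upper_bound[of "- A" N] A by (metis uminus_carrier_iff_mat)
  have "- K \<le> t" if "t \<in> S" for t
    using that K A by (fastforce simp: S_def)
  then have S_bdd: "bdd_below S" by (rule bdd_belowI)
  have m_le: "m * (x \<bullet> x) \<le> x \<bullet> (A *\<^sub>v x)" if x: "x \<in> carrier_vec N" for x
  proof (cases "x = 0\<^sub>v N")
    case True
    then show ?thesis using A by simp
  next
    case False
    define r where "r = sqrt (x \<bullet> x)"
    have "x \<bullet> x > 0"
    proof -
      obtain i where "i < N" "x $ i \<noteq> 0" using False x by (metis carrier_vecD eq_vecI index_zero_vec(1) index_zero_vec(2))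
      then show ?thesis using index_sq_le_scalar_prod[of i x] x
        by (metis carrier_vecD order_less_le_trans zero_less_power2)
    qed
    then have r: "r > 0" "r * r = x \<bullet> x" by (auto simp: r_def)
    define z where "z = (1 / r) \<cdot>\<^sub>v x"
    have z: "z \<in> carrier_vec N" using x by (simp add: z_def)
    have zz: "z \<bullet> z = 1" using x r(1) by (simp add: z_def flip: r(2))
    have "z \<bullet> (A *\<^sub>v z) = (x \<bullet> (A *\<^sub>v x)) / (x \<bullet> x)"
      using x r A by (simp add: z_def mult_mat_vec[OF A x] flip: r(2))
    moreover have "m \<le> z \<bullet> (A *\<^sub>v z)"
      unfolding m_def using z zz S_bdd by (intro cInf_lower) (auto simp: S_def)
    ultimately show ?thesis using \<open>x \<bullet> x > 0\<close> by (simp add: pos_le_divide_eq)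
  qed
  have "eigenvalue A m"
  proof (rule ccontr)
    assume "\<not> eigenvalue A m"
    define B where "B = char_matrix A m"
    have B: "B \<in> carrier_mat N N" using A by (simp add: B_def)
    have "det B \<noteq> 0" using \<open>\<not> eigenvalue A m\<close> eigenvalue_det[OF A] by (simp add: B_def)
    then obtain D where D: "D \<in> carrier_mat N N" "D * B = 1\<^sub>m N"
      using det_non_zero_imp_unit[OF B, of "()"] by (auto simp: Units_def ring_mat_def)
    have Bx: "B *\<^sub>v x = A *\<^sub>v x + (- m) \<cdot>\<^sub>v x" if "x \<in> carrier_vec N" for x
    proof -
      have "(- m \<cdot>\<^sub>m 1\<^sub>m N) *\<^sub>v x = (- m) \<cdot>\<^sub>v x"
        using that by (auto intro!: eq_vecI)
      then show ?thesis using that A unfolding B_def char_matrix_def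
        by (subst add_mult_distrib_mat_vec[of _ N N]) auto
    qed
    have Bform: "x \<bullet> (B *\<^sub>v x) = x \<bullet> (A *\<^sub>v x) - m * (x \<bullet> x)" if "x \<in> carrier_vec N" for x
      using that A by (simp add: Bx scalar_prod_add_distrib[of _ N])
    have Bsym: "x \<bullet> (B *\<^sub>v z) = z \<bullet> (B *\<^sub>v x)"
      if "x \<in> carrier_vec N" "z \<in> carrier_vec N" for x z
      using that A symmetric_form_commute[OF A sym that] comm_scalar_prod[OF that]
      by (simp add: Bx scalar_prod_add_distrib[of _ N])
    obtain K where K: "K > 0" "\<And>x. x \<in> carrier_vec N \<Longrightarrow> x \<bullet> (B *\<^sub>v x) \<le> K * (x \<bullet> x)"
      using form_upper_bound[OF B] by blast
    have "transpose_mat D * D \<in> carrier_mat N N" using D by auto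
    then obtain L where L: "L > 0"
      "\<And>x. x \<in> carrier_vec N \<Longrightarrow> x \<bullet> ((transpose_mat D * D) *\<^sub>v x) \<le> L * (x \<bullet> x)"
      using form_upper_bound by blast
    \<comment> \<open>For a unit vector x let z = B x, so that D z = x. Then 1 <= L |z|^2 and |z|^2
      <= K (x . z) = K (t - m), hence S stays above its infimum m by 1 / (K L).\<close>
    have "m + 1 / (K * L) \<le> t" if "t \<in> S" for t
    proof -
      obtain x where x: "x \<in> carrier_vec N" "x \<bullet> x = 1" and t: "t = x \<bullet> (A *\<^sub>v x)"
        using \<open>t \<in> S\<close> by (auto simp: S_def)
      define z where "z = B *\<^sub>v x"
      have z: "z \<in> carrier_vec N" using B x by (simp add: z_def)
      have Dz: "D *\<^sub>v z = x"
        using assoc_mult_mat_vec[OF D(1) B x(1)] D x by (simp add: z_def)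
      have "(transpose_mat D *\<^sub>v x) \<bullet> z = x \<bullet> (D *\<^sub>v z)"
        using D x z by (intro transpose_vec_mult_scalar[of _ N N]) auto
      moreover have "(transpose_mat D * D) *\<^sub>v z = transpose_mat D *\<^sub>v x"
        using D z by (simp add: Dz assoc_mult_mat_vec[of _ N N _ N])
      moreover have "z \<bullet> (transpose_mat D *\<^sub>v x) = (transpose_mat D *\<^sub>v x) \<bullet> z"
        using D x z by (intro comm_scalar_prod[of _ N]) auto
      ultimately have "1 \<le> L * (z \<bullet> z)"
        using L(2)[OF z] x Dz by simp
      moreover have "z \<bullet> z \<le> K * (x \<bullet> z)"
      proof -
        \<comment> \<open>A gradient step of length 1 / K: the form of B is nonnegative at y and at
          most K |z|^2 at z, which leaves 0 <= x . z - |z|^2 / K.\<close>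
        define y where "y = x + (- 1 / K) \<cdot>\<^sub>v z"
        have y: "y \<in> carrier_vec N" using x z by (simp add: y_def)
        have "B *\<^sub>v y = z + (- 1 / K) \<cdot>\<^sub>v (B *\<^sub>v z)"
          using x z B mult_mat_vec[OF B z, of "- 1 / K"] by (simp add: y_def z_def[symmetric] mult_add_distrib_mat_vec[of _ N N])
        moreover have "x \<bullet> (B *\<^sub>v z) = z \<bullet> z" using Bsym[OF x(1) z] by (simp add: z_def)
        ultimately have "y \<bullet> (B *\<^sub>v y) = x \<bullet> z - 2 / K * (z \<bullet> z) + (1 / K)\<^sup>2 * (z \<bullet> (B *\<^sub>v z))"
          using x z B by (simp add: y_def scalar_prod_add_distrib[of _ N] add_scalar_prod_distrib[of _ N]
              power2_eq_square diff_divide_distrib add_divide_distrib flip: mult_2)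
        moreover have "0 \<le> y \<bullet> (B *\<^sub>v y)" using m_le[OF y] Bform[OF y] by simp
        moreover have "(1 / K)\<^sup>2 * (z \<bullet> (B *\<^sub>v z)) \<le> (1 / K)\<^sup>2 * (K * (z \<bullet> z))"
          using K(2)[OF z] by (intro mult_left_mono) auto
        moreover have "(1 / K)\<^sup>2 * (K * (z \<bullet> z)) = 1 / K * (z \<bullet> z)"
          using K by (simp add: power2_eq_square)
        ultimately have "0 \<le> x \<bullet> z - 1 / K * (z \<bullet> z)" by simp
        then show ?thesis using K by (simp add: field_simps)
      qed
      ultimately have "1 \<le> L * (K * (x \<bullet> z))" using L
        by (meson mult_left_mono less_imp_le order_trans)
      moreover have "x \<bullet> z = t - m" using Bform[OF x(1)] x t by (simp add: z_def)
      ultimately show ?thesis using K L by (simp add: field_simps)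
    qed
    then have "m + 1 / (K * L) \<le> m" unfolding m_def by (intro cInf_greatest S_ne)
    moreover have "1 / (K * L) > 0" using K L by simp
    ultimately show False by linarith
  qed
  then show ?thesis using m_le that by blast
qed

lemma finite_eigenvalues:
  fixes A :: "real mat"
  assumes "A \<in> carrier_mat N N"
  shows "finite {k. eigenvalue A k}"
  using card_finite_spectrum(1)[OF assms] by (simp add: spectrum_def)

text \<open>The eigenvalue that bounds the form is one of those over which \<open>Min\<close>
  ranges. Dimension 0 has no eigenvalues and is treated apart; there both sides are 0.\<close>

lemma lam_min_le_form:
  assumes A: "A \<in> carrier_mat N N" and sym: "transpose_mat A = A" and x: "x \<in> carrier_vec N"
  shows "lam_min A * (x \<bullet> x) \<le> x \<bullet> (A *\<^sub>v x)"
proof (cases "N = 0")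
  case True
  then show ?thesis using assms by (simp add: scalar_prod_def)
next
  case False
  then obtain k where k: "eigenvalue A k" "k * (x \<bullet> x) \<le> x \<bullet> (A *\<^sub>v x)"
    using symmetric_ex_eigenvalue_le_form[OF A sym] x by blast
  have "lam_min A \<le> k"
    unfolding lam_min_def using k finite_eigenvalues[OF A] by (intro Min_le) auto
  then have "lam_min A * (x \<bullet> x) \<le> k * (x \<bullet> x)"
    by (intro mult_right_mono scalar_prod_self_nonneg)
  then show ?thesis using k by linarith
qed

text \<open>The lower bound for \<open>- A\<close>, whose eigenvalues are those of \<open>A\<close>
  with the sign changed.\<close>

lemma form_le_lam_max:
  assumes A: "A \<in> carrier_mat N N" and sym: "transpose_mat A = A" and x: "x \<in> carrier_vec N"
  shows "x \<bullet> (A *\<^sub>v x) \<le> lam_max A * (x \<bullet> x)"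
proof (cases "N = 0")
  case True
  then show ?thesis using assms by (simp add: scalar_prod_def)
next
  case False
  have "transpose_mat (- A) = - A" using sym by (metis transpose_uminus)
  moreover have "- A \<in> carrier_mat N N" using A by simp
  ultimately obtain k where k: "eigenvalue (- A) k" "k * (x \<bullet> x) \<le> x \<bullet> (- A *\<^sub>v x)"
    using symmetric_ex_eigenvalue_le_form[of "- A" N] False x by blast
  then obtain v where v: "v \<in> carrier_vec N" "v \<noteq> 0\<^sub>v N" "- A *\<^sub>v v = k \<cdot>\<^sub>v v"
    using A by (auto simp: eigenvalue_def eigenvector_def)
  then have "A *\<^sub>v v = - (k \<cdot>\<^sub>v v)"
    using A by (metis carrier_matD(2) carrier_vecD uminus_mult_mat_vec uminus_uminus_vec)
  then have "A *\<^sub>v v = (- k) \<cdot>\<^sub>v v" using v by (auto intro!: eq_vecI)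
  then have "eigenvalue A (- k)" using v A unfolding eigenvalue_def eigenvector_def by auto
  then have "- k \<le> lam_max A"
    unfolding lam_max_def using finite_eigenvalues[OF A] by (intro Max_ge) auto
  then have "- k * (x \<bullet> x) \<le> lam_max A * (x \<bullet> x)"
    by (intro mult_right_mono scalar_prod_self_nonneg)
  then show ?thesis using k A x by simp
qed

section \<open>Regularised least squares\<close>

lemma Pinv_carrier: "Pinv s u p q n \<in> carrier_mat (p + q) (p + q)"
  by (simp add: Pinv_def)

lemma Pinv_symmetric: "transpose_mat (Pinv s u p q n) = Pinv s u p q n"
  by (rule eq_matI) (auto simp: Pinv_def mult.commute intro!: sum.cong)

lemma Pinv_mult_index:
  assumes "j < p + q" "x \<in> carrier_vec (p + q)"
  shows "(Pinv s u p q n *\<^sub>v x) $ j =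
    x $ j + (\<Sum>i<n. psi s u p q i $ j * (\<Sum>k<p + q. psi s u p q i $ k * x $ k))"
proof -
  have "(Pinv s u p q n *\<^sub>v x) $ j = (\<Sum>k<p + q. ((if j = k then 1 else 0)
      + (\<Sum>i<n. psi s u p q i $ j * psi s u p q i $ k)) * x $ k)"
    using assms by (auto simp: Pinv_def scalar_prod_def lessThan_atLeast0 intro!: sum.cong)
  also have "\<dots> = (\<Sum>k<p + q. (if j = k then x $ k else 0)
      + (\<Sum>i<n. psi s u p q i $ j * psi s u p q i $ k * x $ k))"
    by (rule sum.cong) (auto simp: distrib_right sum_distrib_right)
  also have "\<dots> = x $ j + (\<Sum>k<p + q. \<Sum>i<n. psi s u p q i $ j * psi s u p q i $ k * x $ k)"
    using assms by (simp add: sum.distrib)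
  also have "(\<Sum>k<p + q. \<Sum>i<n. psi s u p q i $ j * psi s u p q i $ k * x $ k) =
      (\<Sum>i<n. psi s u p q i $ j * (\<Sum>k<p + q. psi s u p q i $ k * x $ k))"
    by (subst sum.swap) (simp add: sum_distrib_left mult.assoc)
  finally show ?thesis .
qed

lemma Pinv_form:
  assumes x: "x \<in> carrier_vec (p + q)"
  shows "x \<bullet> (Pinv s u p q n *\<^sub>v x) =
    (\<Sum>j<p + q. (x $ j)\<^sup>2) + (\<Sum>i<n. (\<Sum>j<p + q. psi s u p q i $ j * x $ j)\<^sup>2)"
proof -
  have "x \<bullet> (Pinv s u p q n *\<^sub>v x) = (\<Sum>j<p + q. x $ j *
      (x $ j + (\<Sum>i<n. psi s u p q i $ j * (\<Sum>k<p + q. psi s u p q i $ k * x $ k))))"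
    using x Pinv_carrier[of s u p q n]
    by (auto simp: scalar_prod_def[of x] lessThan_atLeast0 Pinv_mult_index simp del: index_mult_mat_vec intro!: sum.cong)
  also have "\<dots> = (\<Sum>j<p + q. (x $ j)\<^sup>2)
      + (\<Sum>j<p + q. \<Sum>i<n. (psi s u p q i $ j * x $ j) * (\<Sum>k<p + q. psi s u p q i $ k * x $ k))"
    by (simp add: distrib_left sum.distrib power2_eq_square sum_distrib_left mult_ac)
  also have "(\<Sum>j<p + q. \<Sum>i<n. (psi s u p q i $ j * x $ j) * (\<Sum>k<p + q. psi s u p q i $ k * x $ k))
      = (\<Sum>i<n. (\<Sum>j<p + q. psi s u p q i $ j * x $ j)\<^sup>2)"
    by (subst sum.swap) (simp add: power2_eq_square sum_distrib_right)
  finally show ?thesis .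
qed

lemma scalar_prod_self_eq:
  "x \<in> carrier_vec N \<Longrightarrow> x \<bullet> x = (\<Sum>j<N. (x $ j :: real)\<^sup>2)"
  by (auto simp: scalar_prod_def lessThan_atLeast0 power2_eq_square)

text \<open>The first sum on the right comes from the identity in \<open>Pinv\<close>; the range
  \<open>Suc n\<close> appears because \<open>lmin\<close> at n refers to the matrix of the
  regressors 0 to n.\<close>

lemma lmin_le_form:
  fixes x :: "nat \<Rightarrow> real"
  shows "lmin s u p q n * (\<Sum>j<p + q. (x j)\<^sup>2) \<le>
    (\<Sum>j<p + q. (x j)\<^sup>2) + (\<Sum>i<Suc n. (\<Sum>j<p + q. x j * psi s u p q i $ j)\<^sup>2)"
proof -
  define X where "X = vec (p + q) x"
  have X: "X \<in> carrier_vec (p + q)" by (simp add: X_def)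
  have "(\<Sum>j<p + q. psi s u p q i $ j * X $ j) = (\<Sum>j<p + q. x j * psi s u p q i $ j)" for i
    by (rule sum.cong) (auto simp: X_def)
  moreover have "(\<Sum>j<p + q. (X $ j)\<^sup>2) = (\<Sum>j<p + q. (x j)\<^sup>2)"
    by (rule sum.cong) (auto simp: X_def)
  ultimately show ?thesis
    using lam_min_le_form[OF Pinv_carrier Pinv_symmetric X, of s u "Suc n"]
    by (simp add: lmin_def Pinv_form[OF X] scalar_prod_self_eq[OF X] del: sum.lessThan_Suc)
qed

lemma form_le_lmax:
  fixes x :: "nat \<Rightarrow> real"
  shows "(\<Sum>j<p + q. (x j)\<^sup>2) + (\<Sum>i<Suc n. (\<Sum>j<p + q. x j * psi s u p q i $ j)\<^sup>2)
    \<le> lmax s u p q n * (\<Sum>j<p + q. (x j)\<^sup>2)"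
proof -
  define X where "X = vec (p + q) x"
  have X: "X \<in> carrier_vec (p + q)" by (simp add: X_def)
  have "(\<Sum>j<p + q. psi s u p q i $ j * X $ j) = (\<Sum>j<p + q. x j * psi s u p q i $ j)" for i
    by (rule sum.cong) (auto simp: X_def)
  moreover have "(\<Sum>j<p + q. (X $ j)\<^sup>2) = (\<Sum>j<p + q. (x j)\<^sup>2)"
    by (rule sum.cong) (auto simp: X_def)
  ultimately show ?thesis
    using form_le_lam_max[OF Pinv_carrier Pinv_symmetric X, of s u "Suc n"]
    by (simp add: lmax_def Pinv_form[OF X] scalar_prod_self_eq[OF X] del: sum.lessThan_Suc)
qed

text \<open>On a null vector the form would vanish, and with it the squared norm contributed by the
  identity. So the determinant is nonzero, \<open>mat_inverse\<close> succeeds, and the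
  \<open>the\<close> in \<open>Pmat\<close> picks a genuine inverse.\<close>

lemma Pinv_Pmat: "Pinv s u p q n * Pmat s u p q n = 1\<^sub>m (p + q)"
  and Pmat_carrier: "Pmat s u p q n \<in> carrier_mat (p + q) (p + q)"
proof -
  let ?A = "Pinv s u p q n"
  have "det ?A \<noteq> 0"
  proof
    assume "det ?A = 0"
    then obtain v where v: "v \<in> carrier_vec (p + q)" "v \<noteq> 0\<^sub>v (p + q)" "?A *\<^sub>v v = 0\<^sub>v (p + q)"
      using det_0_iff_vec_prod_zero_field[OF Pinv_carrier] by blast
    then have "(\<Sum>j<p + q. (v $ j)\<^sup>2) + (\<Sum>i<n. (\<Sum>j<p + q. psi s u p q i $ j * v $ j)\<^sup>2) = 0"
      using Pinv_form[OF v(1), of s u n] by simp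
    moreover have "0 \<le> (\<Sum>i<n. (\<Sum>j<p + q. psi s u p q i $ j * v $ j)\<^sup>2)" by (simp add: sum_nonneg)
    moreover have "0 \<le> (\<Sum>j<p + q. (v $ j)\<^sup>2)" by (simp add: sum_nonneg)
    ultimately have "(\<Sum>j<p + q. (v $ j)\<^sup>2) = 0" by linarith
    then have "v = 0\<^sub>v (p + q)" using v(1) by (subst (asm) sum_nonneg_eq_0_iff) (auto intro!: eq_vecI)
    then show False using v by simp
  qed
  then have "?A \<in> Units (ring_mat TYPE(real) (p + q) ())"
    by (rule det_non_zero_imp_unit[OF Pinv_carrier])
  then obtain B where "mat_inverse ?A = Some B"
    using mat_inverse(1)[OF Pinv_carrier, where b = "()"] by (cases "mat_inverse ?A") auto
  then show "?A * Pmat s u p q n = 1\<^sub>m (p + q)" "Pmat s u p q n \<in> carrier_mat (p + q) (p + q)"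
    using mat_inverse(2)[OF Pinv_carrier] by (auto simp: Pmat_def)
qed

lemma theta_ls_carrier: "theta_ls s u p q n \<in> carrier_vec (p + q)"
  unfolding theta_ls_def by (intro mult_mat_vec_carrier[OF Pmat_carrier]) simp

text \<open>The stationarity condition of ridge regression: because of the identity in
  \<open>Pinv\<close>, the residuals are not orthogonal to the regressors, but their correlation
  reproduces the estimate itself.\<close>

lemma theta_ls_normal_equation:
  assumes j: "j < p + q"
  shows "theta_ls s u p q n $ j =
    (\<Sum>i<n. psi s u p q i $ j * (s (Suc i) - (\<Sum>k<p + q. theta_ls s u p q n $ k * psi s u p q i $ k)))"
proof -
  let ?b = "vec (p + q) (\<lambda>j. \<Sum>i<n. psi s u p q i $ j * s (Suc i))"
  have "Pinv s u p q n *\<^sub>v theta_ls s u p q n = (Pinv s u p q n * Pmat s u p q n) *\<^sub>v ?b"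
    unfolding theta_ls_def by (rule assoc_mult_mat_vec[OF Pinv_carrier Pmat_carrier, symmetric]) simp
  then have "(Pinv s u p q n *\<^sub>v theta_ls s u p q n) $ j = (\<Sum>i<n. psi s u p q i $ j * s (Suc i))"
    using j by (simp add: Pinv_Pmat del: index_mult_mat_vec)
  then show ?thesis
    unfolding Pinv_mult_index[OF j theta_ls_carrier]
    by (simp add: right_diff_distrib sum_subtractf mult.commute)
qed

text \<open>The estimate minimises the residual sum plus the squared norm, not
  \<open>sigma_ls\<close> alone. A fixed competitor x therefore costs an extra |x|^2, which is
  negligible against n.\<close>

lemma ridge_optimal:
  fixes x :: "nat \<Rightarrow> real"
  shows "sigma_ls s u p q n + (\<Sum>j<p + q. (theta_ls s u p q n $ j)\<^sup>2) \<le>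
    (\<Sum>i<n. (s (Suc i) - (\<Sum>j<p + q. x j * psi s u p q i $ j))\<^sup>2) + (\<Sum>j<p + q. (x j)\<^sup>2)"
proof -
  define t where "t j = theta_ls s u p q n $ j" for j
  define d where "d j = x j - t j" for j
  define r where "r i = s (Suc i) - (\<Sum>j<p + q. t j * psi s u p q i $ j)" for i
  define D where "D i = (\<Sum>j<p + q. d j * psi s u p q i $ j)" for i
  have "(\<Sum>j<p + q. d j * t j) = (\<Sum>j<p + q. d j * (\<Sum>i<n. psi s u p q i $ j * r i))"
  proof (rule sum.cong[OF refl])
    fix j assume "j \<in> {..<p + q}"
    then have "t j = (\<Sum>i<n. psi s u p q i $ j * r i)"
      unfolding t_def r_def by (intro theta_ls_normal_equation) simp
    then show "d j * t j = d j * (\<Sum>i<n. psi s u p q i $ j * r i)" by simp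
  qed
  also have "\<dots> = (\<Sum>j<p + q. \<Sum>i<n. r i * (d j * psi s u p q i $ j))"
    by (simp add: sum_distrib_left mult_ac)
  also have "\<dots> = (\<Sum>i<n. r i * D i)"
    by (subst sum.swap) (simp add: D_def sum_distrib_left)
  \<comment> \<open>The cross terms of the two expansions around t are - 2 sum r D and + 2 sum d t;
    by this identity they cancel.\<close>
  finally have cross: "(\<Sum>j<p + q. d j * t j) = (\<Sum>i<n. r i * D i)" .
  have "s (Suc i) - (\<Sum>j<p + q. x j * psi s u p q i $ j) = r i - D i" for i
    by (simp add: r_def D_def d_def left_diff_distrib sum_subtractf)
  then have "(\<Sum>i<n. (s (Suc i) - (\<Sum>j<p + q. x j * psi s u p q i $ j))\<^sup>2)
      = (\<Sum>i<n. (r i)\<^sup>2) - 2 * (\<Sum>i<n. r i * D i) + (\<Sum>i<n. (D i)\<^sup>2)"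
    by (simp add: power2_diff sum.distrib sum_subtractf sum_distrib_left mult_ac)
  moreover have "(\<Sum>j<p + q. (x j)\<^sup>2) = (\<Sum>j<p + q. (t j + d j)\<^sup>2)" by (simp add: d_def)
  then have "(\<Sum>j<p + q. (x j)\<^sup>2) = (\<Sum>j<p + q. (t j)\<^sup>2) + 2 * (\<Sum>j<p + q. d j * t j) + (\<Sum>j<p + q. (d j)\<^sup>2)"
    by (simp add: power2_sum sum.distrib sum_distrib_left mult_ac)
  moreover have "0 \<le> (\<Sum>i<n. (D i)\<^sup>2)" "0 \<le> (\<Sum>j<p + q. (d j)\<^sup>2)" by (simp_all add: sum_nonneg)
  moreover have "sigma_ls s u p q n = (\<Sum>i<n. (r i)\<^sup>2)" by (simp add: sigma_ls_def r_def t_def)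
  moreover have "(\<Sum>j<p + q. (theta_ls s u p q n $ j)\<^sup>2) = (\<Sum>j<p + q. (t j)\<^sup>2)" by (simp add: t_def)
  ultimately show ?thesis using cross by linarith
qed

section \<open>A single realisation\<close>

lemma sum_lessThan_add:
  fixes f :: "nat \<Rightarrow> 'a::comm_monoid_add"
  shows "(\<Sum>j<m + k. f j) = (\<Sum>j<m. f j) + (\<Sum>j<k. f (m + j))"
  by (induction k) (auto simp: add.assoc)

section \<open>Comparison with linear growth\<close>

lemma eventually_const_le_linear:
  fixes C \<delta> :: real
  assumes "\<delta> > 0"
  shows "\<forall>\<^sub>F n in sequentially. C \<le> \<delta> * real n"
proof -
  obtain m where m: "C / \<delta> \<le> real m" using real_arch_simple by blast
  show ?thesis
  proof (rule eventually_sequentiallyI[of m])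
    fix n assume "m \<le> n"
    then have "C / \<delta> \<le> real n" using m by linarith
    then show "C \<le> \<delta> * real n" using assms by (simp add: field_simps)
  qed
qed

lemma eventually_const_less_linear:
  fixes C \<delta> :: real
  assumes "\<delta> > 0"
  shows "\<forall>\<^sub>F n in sequentially. C < \<delta> * real n"
  by (rule eventually_mono[OF eventually_const_le_linear[OF assms, of "C + 1"]]) simp

text \<open>The weights may vary with n in any way as long as they stay bounded: a bounded
  combination of finitely many o(n) terms is o(n). This is how the data-dependent estimation error
  is separated from the noise.\<close>

lemma eventually_weighted_sum_le_linear:
  fixes g f :: "nat \<Rightarrow> nat \<Rightarrow> real"
  assumes g: "\<And>j. j < N \<Longrightarrow> (\<lambda>n. g n j / real n) \<longlonglongrightarrow> 0"
    and f: "\<forall>\<^sub>F n in sequentially. \<forall>j<N. \<bar>f n j\<bar> \<le> B" and \<delta>: "\<delta> > 0"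
  shows "\<forall>\<^sub>F n in sequentially. \<bar>\<Sum>j<N. f n j * g n j\<bar> \<le> \<delta> * real n"
proof -
  have "(\<lambda>n. B * (\<Sum>j<N. \<bar>g n j / real n\<bar>)) \<longlonglongrightarrow> B * (\<Sum>j<N. 0)"
    by (intro tendsto_mult_left tendsto_sum tendsto_rabs_zero g) auto
  then have "\<forall>\<^sub>F n in sequentially. B * (\<Sum>j<N. \<bar>g n j / real n\<bar>) < \<delta>"
    by (rule order_tendstoD(2)) (use \<delta> in simp)
  with f eventually_gt_at_top[of 0] show ?thesis
  proof eventually_elim
    case (elim n)
    have "\<bar>\<Sum>j<N. f n j * g n j\<bar> \<le> (\<Sum>j<N. \<bar>f n j\<bar> * \<bar>g n j\<bar>)"
      by (rule order_trans[OF sum_abs]) (simp add: abs_mult)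
    also have "\<dots> \<le> (\<Sum>j<N. B * \<bar>g n j\<bar>)"
      using elim by (intro sum_mono mult_right_mono) auto
    also have "\<dots> = B * (\<Sum>j<N. \<bar>g n j / real n\<bar>) * real n"
      using elim by (simp add: sum_distrib_left sum_distrib_right)
    also have "\<dots> \<le> \<delta> * real n" using elim by (intro mult_right_mono) auto
    finally show ?case .
  qed
qed

text \<open>A single realisation of the quantized system: \<open>R i\<close> is the regression part of the output
  \<open>s (i + 1)\<close>, \<open>h\<close> bounds the accumulated quantization error, and \<open>K\<close> stands for
  \<open>(1 + p\<^sup>* c) \<epsilon>\<close>.\<close>

locale quantized_path =
  fixes s u w R a b l :: "nat \<Rightarrow> real" and p0 pstar qstar :: nat
    and c1 c3 \<gamma> \<alpha>1 \<alpha>2 h K C :: real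
  assumes p0_le: "p0 \<le> pstar" and pstar_pos: "0 < pstar"
    and regression: "\<And>p i. p0 \<le> p \<Longrightarrow>
      (\<Sum>j<p + qstar. theta_bar a b p qstar $ j * psi s u p qstar i $ j) = R i"
    and quantization: "\<forall>\<^sub>F i in sequentially. \<bar>s (Suc i) - R i - w (Suc i)\<bar> \<le> h"
    and noise: "\<And>p j. p \<le> pstar \<Longrightarrow> j < p + qstar \<Longrightarrow>
      (\<lambda>n. (\<Sum>i<n. psi s u p qstar i $ j * w (Suc i)) / real n) \<longlonglongrightarrow> 0"
    and energy: "\<forall>\<^sub>F n in sequentially. (\<Sum>i<n. (w (Suc i))\<^sup>2) \<le> C * real n"
    and c1_pos: "0 < c1" and c3_pos: "0 < c3"
    and lmin_ge: "\<And>p. p \<le> pstar \<Longrightarrow> \<forall>\<^sub>F n in sequentially. c1 * real (n + 1) \<le> lmin s u p qstar n"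
    and lmax_le: "\<forall>\<^sub>F n in sequentially. lmax s u p0 qstar n \<le> c3 * real (n + 1)"
    and \<gamma>_bound: "\<forall>\<^sub>F n in sequentially. \<forall>p\<le>p0. vnorm (theta_tilde a b s u p0 qstar p n) \<le> \<gamma>"
    and h_sq_less: "h\<^sup>2 < K"
    and \<alpha>1_pos: "0 < \<alpha>1" and \<alpha>2_pos: "0 < \<alpha>2" and \<alpha>2_less: "\<alpha>2 < 1"
    and l_lower: "\<And>n. (5 * K + \<alpha>1) * real n \<le> l n"
    and l_upper: "\<And>n. l n \<le> \<alpha>2 / real pstar *
      ((a p0)\<^sup>2 * c1 - 2 * \<gamma> * sqrt (c3 * K) - 3 * K) * real n"
begin

section \<open>Energy of the disturbances and bounds for the quadratic form along one path\<close>

definition v where "v i = s (Suc i) - R i"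
definition \<eta> where "\<eta> i = s (Suc i) - R i - w (Suc i)"

lemma v_eq: "v i = w (Suc i) + \<eta> i"
  by (simp add: v_def \<eta>_def)

lemma K_pos: "0 < K"
  using h_sq_less by (metis le_less_trans zero_le_power2)

text \<open>The finitely many terms that may exceed h add a constant, which the gap between h^2 and
  K' absorbs.\<close>

lemma sum_\<eta>_sq_le:
  assumes "h\<^sup>2 < K'"
  shows "\<forall>\<^sub>F n in sequentially. (\<Sum>i<n. (\<eta> i)\<^sup>2) \<le> K' * real n"
proof -
  obtain m where m: "\<And>i. i \<ge> m \<Longrightarrow> \<bar>\<eta> i\<bar> \<le> h"
    using quantization by (auto simp: eventually_sequentially \<eta>_def)
  have bound: "(\<Sum>i<n. (\<eta> i)\<^sup>2) \<le> (\<Sum>i<m. (\<eta> i)\<^sup>2) + h\<^sup>2 * real n" for n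
  proof -
    have "(\<Sum>i<n. (\<eta> i)\<^sup>2) \<le> (\<Sum>i<n. (if i < m then (\<eta> i)\<^sup>2 else 0) + h\<^sup>2)"
      using m by (intro sum_mono) (auto simp: abs_le_square_iff[symmetric] order_trans[OF m abs_ge_self] not_less)
    also have "\<dots> = (\<Sum>i\<in>{..<n} \<inter> {..<m}. (\<eta> i)\<^sup>2) + h\<^sup>2 * real n"
      by (simp add: sum.distrib sum.If_cases lessThan_def)
    also have "(\<Sum>i\<in>{..<n} \<inter> {..<m}. (\<eta> i)\<^sup>2) \<le> (\<Sum>i<m. (\<eta> i)\<^sup>2)"
      by (intro sum_mono2) auto
    finally show ?thesis by simp
  qed
  from eventually_const_le_linear[of "K' - h\<^sup>2" "\<Sum>i<m. (\<eta> i)\<^sup>2"] assms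
  have "\<forall>\<^sub>F n in sequentially. (\<Sum>i<m. (\<eta> i)\<^sup>2) \<le> (K' - h\<^sup>2) * real n" by simp
  then show ?thesis
  proof eventually_elim
    case (elim n)
    then show ?case using bound[of n] by (simp add: algebra_simps)
  qed
qed

lemma sum_v_sq_le: "\<forall>\<^sub>F n in sequentially. (\<Sum>i<n. (v i)\<^sup>2) \<le> (2 * C + 2 * K) * real n"
  using energy sum_\<eta>_sq_le[OF h_sq_less]
proof eventually_elim
  case (elim n)
  have "(v i)\<^sup>2 \<le> 2 * (w (Suc i))\<^sup>2 + 2 * (\<eta> i)\<^sup>2" for i
    using sum_squares_bound[of "w (Suc i)" "\<eta> i"] by (simp add: v_eq power2_sum)
  then have "(\<Sum>i<n. (v i)\<^sup>2) \<le> (\<Sum>i<n. 2 * (w (Suc i))\<^sup>2 + 2 * (\<eta> i)\<^sup>2)"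
    by (intro sum_mono)
  also have "\<dots> = 2 * (\<Sum>i<n. (w (Suc i))\<^sup>2) + 2 * (\<Sum>i<n. (\<eta> i)\<^sup>2)"
    by (simp add: sum.distrib sum_distrib_left)
  finally show ?case using elim by (simp add: algebra_simps)
qed

text \<open>The shift by one turns c1 (n + 1), stated for n + 1 regressors, into c1 n for n of them.
  The quantifier over x stands inside the filter, so that x may later be the estimation error at
  time n.\<close>

lemma lmin_ge_form:
  assumes "p \<le> pstar"
  shows "\<forall>\<^sub>F n in sequentially. \<forall>x. c1 * real n * (\<Sum>j<p + qstar. (x j)\<^sup>2) \<le>
    (\<Sum>j<p + qstar. (x j)\<^sup>2) + (\<Sum>i<n. (\<Sum>j<p + qstar. x j * psi s u p qstar i $ j)\<^sup>2)"
proof (subst eventually_sequentially_Suc[symmetric])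
  show "\<forall>\<^sub>F n in sequentially. \<forall>x. c1 * real (Suc n) * (\<Sum>j<p + qstar. (x j)\<^sup>2) \<le>
    (\<Sum>j<p + qstar. (x j)\<^sup>2) + (\<Sum>i<Suc n. (\<Sum>j<p + qstar. x j * psi s u p qstar i $ j)\<^sup>2)"
    using lmin_ge[OF assms]
  proof eventually_elim
    case (elim n)
    show ?case
    proof
      fix x :: "nat \<Rightarrow> real"
      have "c1 * real (Suc n) * (\<Sum>j<p + qstar. (x j)\<^sup>2) \<le> lmin s u p qstar n * (\<Sum>j<p + qstar. (x j)\<^sup>2)"
        using elim by (intro mult_right_mono sum_nonneg) auto
      then show "c1 * real (Suc n) * (\<Sum>j<p + qstar. (x j)\<^sup>2) \<le>
          (\<Sum>j<p + qstar. (x j)\<^sup>2) + (\<Sum>i<Suc n. (\<Sum>j<p + qstar. x j * psi s u p qstar i $ j)\<^sup>2)"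
        using lmin_le_form[of s u p qstar n x] by linarith
    qed
  qed
qed

lemma form_le_lmax_linear:
  "\<forall>\<^sub>F n in sequentially. \<forall>x. (\<Sum>i<n. (\<Sum>j<p0 + qstar. x j * psi s u p0 qstar i $ j)\<^sup>2)
    \<le> c3 * real n * (\<Sum>j<p0 + qstar. (x j)\<^sup>2)"
proof (subst eventually_sequentially_Suc[symmetric])
  show "\<forall>\<^sub>F n in sequentially. \<forall>x. (\<Sum>i<Suc n. (\<Sum>j<p0 + qstar. x j * psi s u p0 qstar i $ j)\<^sup>2)
    \<le> c3 * real (Suc n) * (\<Sum>j<p0 + qstar. (x j)\<^sup>2)"
    using lmax_le
  proof eventually_elim
    case (elim n)
    show ?case
    proof
      fix x :: "nat \<Rightarrow> real"
      have "lmax s u p0 qstar n * (\<Sum>j<p0 + qstar. (x j)\<^sup>2) \<le> c3 * real (Suc n) * (\<Sum>j<p0 + qstar. (x j)\<^sup>2)"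
        using elim by (intro mult_right_mono sum_nonneg) auto
      moreover have "0 \<le> (\<Sum>j<p0 + qstar. (x j)\<^sup>2)" by (simp add: sum_nonneg)
      ultimately show "(\<Sum>i<Suc n. (\<Sum>j<p0 + qstar. x j * psi s u p0 qstar i $ j)\<^sup>2)
          \<le> c3 * real (Suc n) * (\<Sum>j<p0 + qstar. (x j)\<^sup>2)"
        using form_le_lmax[of x p0 qstar s u n] by linarith
    qed
  qed
qed

text \<open>The bounded price of letting the true parameter compete in the ridge problem.\<close>

definition T where "T p = (\<Sum>j<p + qstar. (theta_bar a b p qstar $ j)\<^sup>2)"

lemma sigma_le:
  assumes "p0 \<le> p"
  shows "sigma_ls s u p qstar n \<le> (\<Sum>i<n. (v i)\<^sup>2) + T p"
proof -
  have "0 \<le> (\<Sum>j<p + qstar. (theta_ls s u p qstar n $ j)\<^sup>2)" by (simp add: sum_nonneg)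
  then show ?thesis
    using ridge_optimal[of s u p qstar n "\<lambda>j. theta_bar a b p qstar $ j"]
    by (simp add: regression[OF assms] v_def T_def)
qed

text \<open>Fitted and true residual sums are both O(n), hence so is the energy of the difference D
  of the two predictions, while (A5) makes that energy at least of order n times the squared
  parameter error. Boundedness suffices; consistency is not claimed.\<close>

lemma estimation_error_bounded:
  assumes p: "p0 \<le> p" "p \<le> pstar"
  shows "\<forall>\<^sub>F n in sequentially. \<forall>j<p + qstar.
    \<bar>theta_ls s u p qstar n $ j - theta_bar a b p qstar $ j\<bar> \<le> 2 * (4 * (2 * C + 2 * K) + 1) / c1 + 1"
proof -
  have "\<forall>\<^sub>F n in sequentially. 2 * T p \<le> real n"
    using eventually_const_le_linear[of 1 "2 * T p"] by simp
  moreover have "\<forall>\<^sub>F n in sequentially. 1 \<le> c1 / 2 * real n"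
    using c1_pos by (intro eventually_const_le_linear) simp
  ultimately show ?thesis
      using lmin_ge_form[OF p(2)] sum_v_sq_le eventually_gt_at_top[of 0]
  proof eventually_elim
    case (elim n)
    define \<phi> where "\<phi> j = theta_ls s u p qstar n $ j - theta_bar a b p qstar $ j" for j
    define D where "D i = (\<Sum>j<p + qstar. \<phi> j * psi s u p qstar i $ j)" for i
    define F where "F = (\<Sum>j<p + qstar. (\<phi> j)\<^sup>2)"
    \<comment> \<open>Since sum D^2 <= 4 sum v^2 + 2 T, the factor 4 multiplies the constant for sum
      v^2, and the final 1 pays for 2 T <= n.\<close>
    define B where "B = 4 * (2 * C + 2 * K) + 1"
    have F: "0 \<le> F" by (simp add: F_def sum_nonneg)
    have D: "D i = (\<Sum>j<p + qstar. theta_ls s u p qstar n $ j * psi s u p qstar i $ j) - R i" for i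
      by (simp add: D_def \<phi>_def left_diff_distrib sum_subtractf regression[OF p(1)])
    have "(D i)\<^sup>2 \<le> 2 * (v i - D i)\<^sup>2 + 2 * (v i)\<^sup>2" for i
    proof -
      have "0 \<le> (2 * v i - D i)\<^sup>2" by simp
      then show ?thesis by (simp add: power2_eq_square algebra_simps)
    qed
    then have "(\<Sum>i<n. (D i)\<^sup>2) \<le> (\<Sum>i<n. 2 * (v i - D i)\<^sup>2 + 2 * (v i)\<^sup>2)" by (intro sum_mono)
    also have "\<dots> = 2 * (\<Sum>i<n. (v i - D i)\<^sup>2) + 2 * (\<Sum>i<n. (v i)\<^sup>2)"
      by (simp add: sum.distrib sum_distrib_left)
    also have "(\<Sum>i<n. (v i - D i)\<^sup>2) = sigma_ls s u p qstar n"
      by (simp add: sigma_ls_def v_def D)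
    finally have "(\<Sum>i<n. (D i)\<^sup>2) \<le> 4 * (\<Sum>i<n. (v i)\<^sup>2) + 2 * T p"
      using sigma_le[OF p(1), of n] by linarith
    then have "(\<Sum>i<n. (D i)\<^sup>2) \<le> B * real n"
      using elim(1,4) by (simp add: B_def algebra_simps)
    then have "c1 * real n * F \<le> F + B * real n"
      using elim(3)[rule_format, of \<phi>] by (simp add: D_def F_def)
    \<comment> \<open>Half of the quadratic lower bound absorbs the ridge term F, which explains the
      factor 2 in 2 B / c1.\<close>
    moreover have "1 * F \<le> c1 / 2 * real n * F" using elim(2) F by (intro mult_right_mono) auto
    ultimately have "(c1 * F) * real n \<le> (2 * B) * real n" by (simp add: mult_ac)
    then have "c1 * F \<le> 2 * B" using elim(5) by (simp add: mult_le_cancel_right)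
    then have F_le: "F \<le> 2 * B / c1" using c1_pos by (simp add: field_simps)
    show ?case
    proof (intro allI impI)
      fix j assume "j < p + qstar"
      then have "(\<phi> j)\<^sup>2 \<le> F" unfolding F_def by (intro member_le_sum) auto
      moreover have "\<bar>\<phi> j\<bar> \<le> (\<phi> j)\<^sup>2 + 1"
      proof -
        have "0 \<le> (\<bar>\<phi> j\<bar> - 1)\<^sup>2 + \<bar>\<phi> j\<bar>" by simp
        then show ?thesis by (simp add: power2_diff)
      qed
      ultimately show "\<bar>theta_ls s u p qstar n $ j - theta_bar a b p qstar $ j\<bar> \<le> 2 * (4 * (2 * C + 2 * K) + 1) / c1 + 1"
        using F_le by (simp add: \<phi>_def B_def)
    qed
  qed
qed

section \<open>Lower bounds for the residual sum above and below the true order\<close>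

lemma weighted_noise_swap:
  fixes x :: "nat \<Rightarrow> real"
  shows "(\<Sum>j<N. x j * (\<Sum>i<n. psi s u p q i $ j * w (Suc i))) =
    (\<Sum>i<n. w (Suc i) * (\<Sum>j<N. x j * psi s u p q i $ j))"
  unfolding sum_distrib_left by (subst sum.swap) (simp add: mult_ac)

lemma sigma_ge_overfit:
  assumes p: "p0 \<le> p" "p \<le> pstar" and \<delta>: "0 < \<delta>"
  shows "\<forall>\<^sub>F n in sequentially. (\<Sum>i<n. (v i)\<^sup>2) - (K + \<delta>) * real n \<le> sigma_ls s u p qstar n"
proof -
  have "\<delta> / 2 > 0" using \<delta> by simp
  have "\<forall>\<^sub>F n in sequentially. \<bar>\<Sum>j<p + qstar. (theta_ls s u p qstar n $ j - theta_bar a b p qstar $ j) *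
      (\<Sum>i<n. psi s u p qstar i $ j * w (Suc i))\<bar> \<le> \<delta> / 2 * real n"
    by (rule eventually_weighted_sum_le_linear[OF _ estimation_error_bounded[OF p] \<open>\<delta> / 2 > 0\<close>])
      (rule noise[OF p(2)])
  from this sum_\<eta>_sq_le[OF h_sq_less]
  show ?thesis
  proof eventually_elim
    case (elim n)
    define \<phi> where "\<phi> j = theta_ls s u p qstar n $ j - theta_bar a b p qstar $ j" for j
    define D where "D i = (\<Sum>j<p + qstar. \<phi> j * psi s u p qstar i $ j)" for i
    have D: "D i = (\<Sum>j<p + qstar. theta_ls s u p qstar n $ j * psi s u p qstar i $ j) - R i" for i
      by (simp add: D_def \<phi>_def left_diff_distrib sum_subtractf regression[OF p(1)])
    \<comment> \<open>The exact identity is (v - D)^2 = v^2 - \<eta>^2 - 2 w D + (\<eta> - D)^2.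
      Absorbing the product of \<eta> and D into a square keeps the size of the estimation error out
      of the bound.\<close>
    have "(v i)\<^sup>2 - (\<eta> i)\<^sup>2 - 2 * (w (Suc i) * D i) \<le> (v i - D i)\<^sup>2" for i
    proof -
      have "0 \<le> (\<eta> i - D i)\<^sup>2" by simp
      then show ?thesis by (simp add: v_eq power2_eq_square algebra_simps)
    qed
    then have "(\<Sum>i<n. (v i)\<^sup>2 - (\<eta> i)\<^sup>2 - 2 * (w (Suc i) * D i)) \<le> (\<Sum>i<n. (v i - D i)\<^sup>2)"
      by (intro sum_mono)
    moreover have "(\<Sum>i<n. (v i - D i)\<^sup>2) = sigma_ls s u p qstar n"
      by (simp add: sigma_ls_def v_def D)
    moreover have "(\<Sum>i<n. w (Suc i) * D i) \<le> \<delta> / 2 * real n"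
      using elim(1) unfolding weighted_noise_swap D_def \<phi>_def by linarith
    moreover have "(\<Sum>i<n. (v i)\<^sup>2 - (\<eta> i)\<^sup>2 - 2 * (w (Suc i) * D i))
        = (\<Sum>i<n. (v i)\<^sup>2) - (\<Sum>i<n. (\<eta> i)\<^sup>2) - 2 * (\<Sum>i<n. w (Suc i) * D i)"
      by (simp add: sum_subtractf sum_distrib_left)
    moreover have "(K + \<delta>) * real n = K * real n + 2 * (\<delta> / 2 * real n)" by (simp add: distrib_right)
    ultimately show ?case using elim(2) by linarith
  qed
qed

text \<open>The inserted zeros hide the lags p to p0 - 1 and the input coefficients move from p + j
  to p0 + j. A fit of order p thus becomes a fit of order p0, to which the eigenvalue bounds of
  order p0 apply.\<close>

lemma theta_hat_regression:
  assumes "p < p0"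
  shows "(\<Sum>j<p0 + qstar. theta_hat s u p0 qstar p n $ j * psi s u p0 qstar i $ j) =
    (\<Sum>j<p + qstar. theta_ls s u p qstar n $ j * psi s u p qstar i $ j)"
proof -
  define F where "F j = theta_hat s u p0 qstar p n $ j * psi s u p0 qstar i $ j" for j
  have "(\<Sum>j<p0 + qstar. F j) = (\<Sum>j<p + (p0 - p). F j) + (\<Sum>j<qstar. F (p0 + j))"
    using assms by (simp add: sum_lessThan_add)
  also have "\<dots> = (\<Sum>j<p. F j) + (\<Sum>j<p0 - p. F (p + j)) + (\<Sum>j<qstar. F (p0 + j))"
    by (simp only: sum_lessThan_add)
  also have "(\<Sum>j<p0 - p. F (p + j)) = 0"
    by (rule sum.neutral) (auto simp: F_def theta_hat_def)
  also have "(\<Sum>j<p. F j) = (\<Sum>j<p. theta_ls s u p qstar n $ j * psi s u p qstar i $ j)"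
    using assms by (intro sum.cong) (auto simp: F_def theta_hat_def psi_def)
  also have "(\<Sum>j<qstar. F (p0 + j)) =
      (\<Sum>j<qstar. theta_ls s u p qstar n $ (p + j) * psi s u p qstar i $ (p + j))"
    using assms by (intro sum.cong) (auto simp: F_def theta_hat_def psi_def)
  finally show ?thesis by (simp add: F_def sum_lessThan_add)
qed

lemma sigma_ge_underfit:
  assumes p: "p < p0" and \<delta>: "0 < \<delta>"
  shows "\<forall>\<^sub>F n in sequentially. (\<Sum>i<n. (v i)\<^sup>2)
    + ((a p0)\<^sup>2 * c1 - 2 * \<gamma> * sqrt (c3 * K) - \<delta>) * real n \<le> sigma_ls s u p qstar n"
proof -
  define \<theta> where "\<theta> n j = theta_tilde a b s u p0 qstar p n $ j" for n j
  have dim: "dim_vec (theta_tilde a b s u p0 qstar p n) = p0 + qstar" for n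
    by (simp add: theta_tilde_def theta_hat_def)
  have \<theta>: "\<theta> n j = theta_bar a b p0 qstar $ j - theta_hat s u p0 qstar p n $ j" if "j < p0 + qstar" for n j
    using that by (simp add: \<theta>_def theta_tilde_def theta_hat_def)
  have norm: "vnorm (theta_tilde a b s u p0 qstar p n) = sqrt (\<Sum>j<p0 + qstar. (\<theta> n j)\<^sup>2)" for n
    by (simp add: vnorm_def dim \<theta>_def)
  have norm_le: "\<forall>\<^sub>F n in sequentially. sqrt (\<Sum>j<p0 + qstar. (\<theta> n j)\<^sup>2) \<le> \<gamma>"
    using \<gamma>_bound by eventually_elim (use p in \<open>auto simp flip: norm\<close>)
  then have coord: "\<forall>\<^sub>F n in sequentially. \<forall>j<p0 + qstar. \<bar>\<theta> n j\<bar> \<le> \<gamma>"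
  proof eventually_elim
    case (elim n)
    show ?case
    proof (intro allI impI)
      fix j assume "j < p0 + qstar"
      then have "(\<theta> n j)\<^sup>2 \<le> (\<Sum>j<p0 + qstar. (\<theta> n j)\<^sup>2)" by (intro member_le_sum) auto
      then have "\<bar>\<theta> n j\<bar> \<le> sqrt (\<Sum>j<p0 + qstar. (\<theta> n j)\<^sup>2)" by (metis real_sqrt_abs real_sqrt_le_iff)
      then show "\<bar>\<theta> n j\<bar> \<le> \<gamma>" using elim by linarith
    qed
  qed
  \<comment> \<open>Splitting of \<delta>: the noise term occurs twice, each time with \<delta> / 4,
    and the other half covers the constant \<open>(a p0)\<^sup>2\<close> lost to the ridge
    term.\<close>
  have "\<delta> / 4 > 0" "\<delta> / 2 > 0" using \<delta> by simp_all
  have "\<forall>\<^sub>F n in sequentially. \<bar>\<Sum>j<p0 + qstar. \<theta> n j *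
      (\<Sum>i<n. psi s u p0 qstar i $ j * w (Suc i))\<bar> \<le> \<delta> / 4 * real n"
    by (rule eventually_weighted_sum_le_linear[OF _ coord \<open>\<delta> / 4 > 0\<close>]) (rule noise[OF p0_le])
  from this norm_le
    sum_\<eta>_sq_le[OF h_sq_less] lmin_ge_form[OF p0_le] form_le_lmax_linear
    eventually_const_le_linear[OF \<open>\<delta> / 2 > 0\<close>, of "(a p0)\<^sup>2"] eventually_const_le_linear[OF c1_pos, of 1]
  show ?thesis
  proof eventually_elim
    case (elim n)
    \<comment> \<open>D has the opposite sign to the overfitting case: it is true minus fitted
      prediction, so the residual is v + D.\<close>
    define D where "D i = (\<Sum>j<p0 + qstar. \<theta> n j * psi s u p0 qstar i $ j)" for i
    define F where "F = (\<Sum>j<p0 + qstar. (\<theta> n j)\<^sup>2)"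
    have F0: "0 \<le> F" by (simp add: F_def sum_nonneg)
    have \<gamma>0: "0 \<le> \<gamma>" using elim(2) F0 by (metis F_def real_sqrt_ge_zero order_trans)
    have "F = (sqrt F)\<^sup>2" using F0 by simp
    also have "\<dots> \<le> \<gamma>\<^sup>2" using elim(2) F0 by (intro power_mono) (auto simp: F_def)
    finally have F\<gamma>: "F \<le> \<gamma>\<^sup>2" .
    have aF: "(a p0)\<^sup>2 \<le> F"
    proof -
      \<comment> \<open>The last output coordinate is one of the inserted zeros because p < p0, so
        the full coefficient of the true parameter remains as error.\<close>
      have "\<theta> n (p0 - 1) = - a p0" using p
        by (simp add: \<theta> theta_bar_def theta_hat_def)
      then have "(a p0)\<^sup>2 = (\<theta> n (p0 - 1))\<^sup>2" by simp
      also have "\<dots> \<le> F" unfolding F_def using p by (intro member_le_sum) auto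
      finally show ?thesis .
    qed
    have D: "D i = R i - (\<Sum>j<p + qstar. theta_ls s u p qstar n $ j * psi s u p qstar i $ j)" for i
    proof -
      have "D i = (\<Sum>j<p0 + qstar. (theta_bar a b p0 qstar $ j - theta_hat s u p0 qstar p n $ j) * psi s u p0 qstar i $ j)"
        unfolding D_def by (rule sum.cong) (auto simp: \<theta>)
      then show ?thesis
        by (simp add: left_diff_distrib sum_subtractf regression theta_hat_regression[OF p])
    qed
    have "sigma_ls s u p qstar n = (\<Sum>i<n. (v i + D i)\<^sup>2)"
      by (simp add: sigma_ls_def v_def D)
    also have "\<dots> = (\<Sum>i<n. (v i)\<^sup>2 + 2 * (w (Suc i) * D i) + 2 * (\<eta> i * D i) + (D i)\<^sup>2)"
      by (rule sum.cong) (auto simp: v_eq power2_eq_square algebra_simps)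
    also have "\<dots> = (\<Sum>i<n. (v i)\<^sup>2) + 2 * (\<Sum>i<n. w (Suc i) * D i) + 2 * (\<Sum>i<n. \<eta> i * D i) + (\<Sum>i<n. (D i)\<^sup>2)"
      by (simp add: sum.distrib sum_distrib_left)
    finally have sigma: "sigma_ls s u p qstar n = (\<Sum>i<n. (v i)\<^sup>2) + 2 * (\<Sum>i<n. w (Suc i) * D i)
      + 2 * (\<Sum>i<n. \<eta> i * D i) + (\<Sum>i<n. (D i)\<^sup>2)" .
    have 1: "- (\<delta> / 4 * real n) \<le> (\<Sum>i<n. w (Suc i) * D i)"
      using elim(1) unfolding weighted_noise_swap D_def by linarith
    have 2: "(c1 * real n - 1) * (a p0)\<^sup>2 \<le> (\<Sum>i<n. (D i)\<^sup>2)"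
    proof -
      have "(c1 * real n - 1) * (a p0)\<^sup>2 \<le> (c1 * real n - 1) * F"
        using aF elim(7) by (intro mult_left_mono) auto
      also have "\<dots> \<le> (\<Sum>i<n. (D i)\<^sup>2)"
        using elim(4)[rule_format, of "\<theta> n"] by (simp add: D_def F_def left_diff_distrib)
      finally show ?thesis .
    qed
    \<comment> \<open>Cauchy-Schwarz with sum \<eta>^2 <= K n and sum D^2 <= c3 n \<gamma>^2. Hence
      the term with the square root in the admissible range of l.\<close>
    have 3: "\<bar>\<Sum>i<n. \<eta> i * D i\<bar> \<le> \<gamma> * sqrt (c3 * K) * real n"
    proof -
      have "(\<Sum>i<n. (D i)\<^sup>2) \<le> c3 * real n * F"
        using elim(5)[rule_format, of "\<theta> n"] by (simp add: D_def F_def)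
      also have "\<dots> \<le> c3 * real n * \<gamma>\<^sup>2" using F\<gamma> c3_pos by (intro mult_left_mono) auto
      finally have DD: "(\<Sum>i<n. (D i)\<^sup>2) \<le> c3 * real n * \<gamma>\<^sup>2" .
      have "(\<Sum>i<n. \<eta> i * D i)\<^sup>2 \<le> (\<Sum>i<n. (\<eta> i)\<^sup>2) * (\<Sum>i<n. (D i)\<^sup>2)"
        by (rule Cauchy_Schwarz_ineq_sum)
      also have "\<dots> \<le> (K * real n) * (c3 * real n * \<gamma>\<^sup>2)"
        using elim(3) DD K_pos by (intro mult_mono) (auto intro: sum_nonneg)
      finally have "\<bar>\<Sum>i<n. \<eta> i * D i\<bar> \<le> sqrt ((K * real n) * (c3 * real n * \<gamma>\<^sup>2))"
        by (metis real_sqrt_abs real_sqrt_le_iff)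
      also have "(K * real n) * (c3 * real n * \<gamma>\<^sup>2) = (c3 * K) * (\<gamma> * real n)\<^sup>2"
        by (simp add: power2_eq_square)
      also have "sqrt \<dots> = \<gamma> * sqrt (c3 * K) * real n"
        using \<gamma>0 by (simp add: real_sqrt_mult)
      finally show ?thesis .
    qed
    have "(a p0)\<^sup>2 * c1 * real n - (a p0)\<^sup>2 \<le> (\<Sum>i<n. (D i)\<^sup>2)" using 2 by (simp add: algebra_simps)
    moreover have "((a p0)\<^sup>2 * c1 - 2 * \<gamma> * sqrt (c3 * K) - \<delta>) * real n
        = (a p0)\<^sup>2 * c1 * real n - 2 * (\<gamma> * sqrt (c3 * K) * real n) - \<delta> * real n"
      by (simp add: algebra_simps)
    ultimately show ?case using sigma 1 3 elim(6) by linarith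
  qed
qed

section \<open>Comparison of the criterion at p0 with every other order\<close>

lemma Lcrit_less_overfit:
  assumes p: "p0 < p" "p \<le> pstar"
  shows "\<forall>\<^sub>F n in sequentially. Lcrit s u l p0 qstar n < Lcrit s u l p qstar n"
proof -
  \<comment> \<open>3 K = 5 K - 2 K: the penalty for one extra lag minus the largest gain in fit,
    where the slack \<delta> is taken to be K.\<close>
  have pos: "0 < 3 * K" using K_pos by simp
  show ?thesis
    using sigma_ge_overfit[OF less_imp_le[OF p(1)] p(2) K_pos] eventually_const_less_linear[OF pos, of "T p0"]
  proof eventually_elim
    case (elim n)
    have "0 \<le> (5 * K + \<alpha>1) * real n" using K_pos \<alpha>1_pos by simp
    then have l0: "0 \<le> l n" using l_lower[of n] by linarith
    have "real p - real p0 \<ge> 1" using p by linarith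
    then have "l n * 1 \<le> l n * (real p - real p0)" using l0 by (rule mult_left_mono)
    moreover have "5 * K * real n \<le> l n"
      using l_lower[of n] \<alpha>1_pos by (simp add: distrib_right) (smt (verit) mult_nonneg_nonneg of_nat_0_le_iff)
    moreover have "Lcrit s u l p qstar n - Lcrit s u l p0 qstar n =
        sigma_ls s u p qstar n - sigma_ls s u p0 qstar n + l n * (real p - real p0)"
      by (simp add: Lcrit_def algebra_simps)
    ultimately show ?case
      using elim sigma_le[OF order_refl, of n] by (simp add: algebra_simps)
  qed
qed

lemma Lcrit_less_underfit:
  assumes p: "p < p0"
  shows "\<forall>\<^sub>F n in sequentially. Lcrit s u l p0 qstar n < Lcrit s u l p qstar n"
proof -
  define G where "G = (a p0)\<^sup>2 * c1 - 2 * \<gamma> * sqrt (c3 * K) - 3 * K"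
  \<comment> \<open>2 K = 3 K - K: the upper bound for l reserves 3 K, the lower bound for the
    residual sum with \<delta> = K gives away only one K.\<close>
  have pos: "0 < 2 * K" using K_pos by simp
  \<comment> \<open>The lower and upper bounds on l at n = 1 are compatible only if the bracket is
    nonnegative.\<close>
  have G: "0 \<le> G"
  proof (rule ccontr)
    assume "\<not> 0 \<le> G"
    then have "\<alpha>2 / real pstar * G \<le> 0" using \<alpha>2_pos by (intro mult_nonneg_nonpos) auto
    moreover have "5 * K + \<alpha>1 \<le> \<alpha>2 / real pstar * G"
      using l_lower[of 1] l_upper[of 1] by (simp add: G_def)
    ultimately show False using K_pos \<alpha>1_pos by linarith
  qed
  show ?thesis
    using sigma_ge_underfit[OF p K_pos] eventually_const_less_linear[OF pos, of "T p0"]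
  proof eventually_elim
    case (elim n)
    have "0 \<le> (5 * K + \<alpha>1) * real n" using K_pos \<alpha>1_pos by simp
    then have l0: "0 \<le> l n" using l_lower[of n] by linarith
    \<comment> \<open>At most pstar lags are saved, and the divisor pstar in the upper bound for l
      pays for all of them.\<close>
    have "l n * (real p0 - real p) \<le> l n * real pstar"
      using p p0_le l0 by (intro mult_left_mono) auto
    also have "\<dots> \<le> (\<alpha>2 / real pstar * G * real n) * real pstar"
      using l_upper[of n] by (intro mult_right_mono) (auto simp: G_def)
    also have "\<dots> = \<alpha>2 * (G * real n)" using pstar_pos by simp
    also have "\<dots> \<le> 1 * (G * real n)" using G \<alpha>2_less by (intro mult_right_mono) auto
    finally have "l n * (real p0 - real p) \<le> G * real n" by simp
    moreover have "((a p0)\<^sup>2 * c1 - 2 * \<gamma> * sqrt (c3 * K) - K) * real n = G * real n + 2 * K * real n"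
      by (simp add: G_def algebra_simps)
    moreover have "Lcrit s u l p qstar n - Lcrit s u l p0 qstar n =
        sigma_ls s u p qstar n - sigma_ls s u p0 qstar n - l n * (real p0 - real p)"
      by (simp add: Lcrit_def algebra_simps)
    ultimately show ?case using elim sigma_le[OF order_refl, of n] by linarith
  qed
qed

text \<open>Finitely many strict inequalities hold simultaneously from some n on, so p0 becomes the
  unique minimiser and the sequence is eventually constant.\<close>

lemma phat_tendsto: "(\<lambda>n. phat s u l pstar qstar n) \<longlonglongrightarrow> p0"
proof (rule tendsto_eventually)
  have "\<forall>\<^sub>F n in sequentially. \<forall>p\<in>{..pstar} - {p0}. Lcrit s u l p0 qstar n < Lcrit s u l p qstar n"
  proof (intro eventually_ball_finite ballI)
    fix p assume "p \<in> {..pstar} - {p0}"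
    then consider "p < p0" | "p0 < p" "p \<le> pstar" by fastforce
    then show "\<forall>\<^sub>F n in sequentially. Lcrit s u l p0 qstar n < Lcrit s u l p qstar n"
      by cases (auto intro: Lcrit_less_underfit Lcrit_less_overfit)
  qed simp
  then show "\<forall>\<^sub>F n in sequentially. phat s u l pstar qstar n = p0"
  proof eventually_elim
    case (elim n)
    show ?case unfolding phat_def
    proof (rule Least_equality)
      show "p0 \<le> pstar \<and> (\<forall>p'\<le>pstar. Lcrit s u l p0 qstar n \<le> Lcrit s u l p' qstar n)"
        using elim p0_le by (metis Diff_iff atMost_iff less_imp_le order_refl singletonD)
      fix p assume "p \<le> pstar \<and> (\<forall>p'\<le>pstar. Lcrit s u l p qstar n \<le> Lcrit s u l p' qstar n)"
      then have "p = p0" using elim p0_le by (meson Diff_iff atMost_iff not_less singletonD)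
      then show "p0 \<le> p" by simp
    qed
  qed
qed

end

section \<open>A strong law for orthogonal sequences\<close>

text \<open>By monotone convergence the series of the \<open>Z n\<close> has finite integral, so it
  converges almost everywhere and its terms tend to 0.\<close>

lemma AE_tendsto_0_of_summable_integral:
  fixes Z :: "nat \<Rightarrow> 'a \<Rightarrow> real"
  assumes int: "\<And>n. integrable M (Z n)" and nn: "\<And>n x. 0 \<le> Z n x"
    and sum: "summable (\<lambda>n. \<integral>x. Z n x \<partial>M)"
  shows "AE x in M. (\<lambda>n. Z n x) \<longlonglongrightarrow> 0"
proof -
  have [measurable]: "Z n \<in> borel_measurable M" for n using int by auto
  have "(\<integral>\<^sup>+x. (\<Sum>n. ennreal (Z n x)) \<partial>M) = (\<Sum>n. \<integral>\<^sup>+x. ennreal (Z n x) \<partial>M)"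
    by (rule nn_integral_suminf) simp
  also have "\<dots> = (\<Sum>n. ennreal (\<integral>x. Z n x \<partial>M))"
    using int nn by (simp add: nn_integral_eq_integral)
  also have "\<dots> \<noteq> \<infinity>"
    using sum nn by (subst suminf_ennreal2) (auto intro!: integral_nonneg_AE)
  finally have "AE x in M. (\<Sum>n. ennreal (Z n x)) \<noteq> \<infinity>"
    by (intro nn_integral_noteq_infinite) auto
  then show ?thesis
  proof eventually_elim
    case (elim x)
    then have "summable (\<lambda>n. Z n x)" using nn by (intro summable_suminf_not_top) auto
    then show ?case by (rule summable_LIMSEQ_zero)
  qed
qed

lemma integrable_mult_of_squares:
  fixes f g :: "'a \<Rightarrow> real"
  assumes [measurable]: "f \<in> borel_measurable M" "g \<in> borel_measurable M"
    and "integrable M (\<lambda>x. (f x)\<^sup>2)" "integrable M (\<lambda>x. (g x)\<^sup>2)"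
  shows "integrable M (\<lambda>x. f x * g x)"
proof (rule Bochner_Integration.integrable_bound)
  show "integrable M (\<lambda>x. (f x)\<^sup>2 + (g x)\<^sup>2)" using assms by simp
  show "AE x in M. norm (f x * g x) \<le> norm ((f x)\<^sup>2 + (g x)\<^sup>2)"
  proof (rule AE_I2)
    fix x show "norm (f x * g x) \<le> norm ((f x)\<^sup>2 + (g x)\<^sup>2)"
    proof -
      have "0 \<le> \<bar>f x\<bar> * \<bar>g x\<bar>" by simp
      then have "\<bar>f x\<bar> * \<bar>g x\<bar> \<le> (f x)\<^sup>2 + (g x)\<^sup>2"
        using sum_squares_bound[of "\<bar>f x\<bar>" "\<bar>g x\<bar>"] by (simp only: power2_abs)
      then show ?thesis by (simp add: abs_mult)
    qed
  qed
qed simp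

lemma second_moment_sum_orthogonal:
  fixes d :: "nat \<Rightarrow> 'a \<Rightarrow> real"
  assumes meas[measurable]: "\<And>i. d i \<in> borel_measurable M"
    and int: "\<And>i. integrable M (\<lambda>x. (d i x)\<^sup>2)"
    and bnd: "\<And>i. (\<integral>x. (d i x)\<^sup>2 \<partial>M) \<le> C"
    and orth: "\<And>i j. i < j \<Longrightarrow> (\<integral>x. d i x * d j x \<partial>M) = 0"
  shows "integrable M (\<lambda>x. (\<Sum>i<n. d i x)\<^sup>2) \<and> (\<integral>x. (\<Sum>i<n. d i x)\<^sup>2 \<partial>M) \<le> C * real n"
proof (induction n)
  case (Suc n)
  have prod: "integrable M (\<lambda>x. d i x * d j x)" for i j
    by (intro integrable_mult_of_squares int meas)
  have *: "(\<Sum>i<Suc n. d i x)\<^sup>2 = (\<Sum>i<n. d i x)\<^sup>2 + (2 * (\<Sum>i<n. d i x * d n x) + (d n x)\<^sup>2)" for x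
    by (simp add: power2_sum sum_distrib_right)
  have "(\<integral>x. (\<Sum>i<n. d i x * d n x) \<partial>M) = 0"
    using orth by (subst Bochner_Integration.integral_sum) (auto intro: prod)
  moreover have "integrable M (\<lambda>x. \<Sum>i<n. d i x * d n x)" by (intro Bochner_Integration.integrable_sum prod)
  ultimately show ?case
    using Suc int[of n] bnd[of n] unfolding * by (simp add: distrib_left)
qed simp

text \<open>Rajchman's argument: the partial sums are controlled along the squares \<open>n\<^sup>2\<close>, and between
  consecutive squares by the sum of the absolute values.\<close>

lemma strong_law_orthogonal:
  fixes d :: "nat \<Rightarrow> 'a \<Rightarrow> real"
  assumes meas[measurable]: "\<And>i. d i \<in> borel_measurable M"
    and int: "\<And>i. integrable M (\<lambda>x. (d i x)\<^sup>2)"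
    and bnd: "\<And>i. (\<integral>x. (d i x)\<^sup>2 \<partial>M) \<le> C"
    and orth: "\<And>i j. i < j \<Longrightarrow> (\<integral>x. d i x * d j x \<partial>M) = 0"
  shows "AE x in M. (\<lambda>n. (\<Sum>i<n. d i x) / real n) \<longlonglongrightarrow> 0"
proof -
  define blk where "blk n x = (\<Sum>i\<in>{n\<^sup>2..<(Suc n)\<^sup>2}. \<bar>d i x\<bar>)" for n x
  \<comment> \<open>The squared average at the time n^2 plus the squared largest possible drift
    until the next square. At n = 0 division by zero makes it 0.\<close>
  define Z where "Z n x = ((\<Sum>i<n\<^sup>2. d i x) / real n ^ 2)\<^sup>2 + (blk n x / real n ^ 2)\<^sup>2" for n x
  have C: "C \<ge> 0"
  proof -
    have "0 \<le> (\<integral>x. (d 0 x)\<^sup>2 \<partial>M)" by (intro integral_nonneg_AE) simp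
    then show ?thesis using bnd[of 0] by linarith
  qed
  have card: "card {n\<^sup>2..<(Suc n)\<^sup>2} = 2 * n + 1" for n :: nat by (simp add: power2_eq_square)
  have blk_le: "(blk n x)\<^sup>2 \<le> (\<Sum>i\<in>{n\<^sup>2..<(Suc n)\<^sup>2}. (d i x)\<^sup>2) * real (2 * n + 1)" for n x
    using sum_squared_le_sum_of_squares[of "\<lambda>i. \<bar>d i x\<bar>" "{n\<^sup>2..<(Suc n)\<^sup>2}"]
    unfolding card by (simp add: blk_def)
  have bound_int: "integrable M (\<lambda>x. (\<Sum>i\<in>{n\<^sup>2..<(Suc n)\<^sup>2}. (d i x)\<^sup>2) * real (2 * n + 1))" for n
    by (intro integrable_mult_left Bochner_Integration.integrable_sum int)
  have [measurable]: "blk n \<in> borel_measurable M" for n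
    unfolding blk_def by measurable
  have blk_int: "integrable M (\<lambda>x. (blk n x)\<^sup>2)" for n
  proof (rule Bochner_Integration.integrable_bound[OF bound_int])
    show "AE x in M. norm ((blk n x)\<^sup>2) \<le> norm ((\<Sum>i\<in>{n\<^sup>2..<(Suc n)\<^sup>2}. (d i x)\<^sup>2) * real (2 * n + 1))"
    proof (rule AE_I2)
      fix x show "norm ((blk n x)\<^sup>2) \<le> norm ((\<Sum>i\<in>{n\<^sup>2..<(Suc n)\<^sup>2}. (d i x)\<^sup>2) * real (2 * n + 1))"
        using blk_le[of n x] by (metis abs_ge_self abs_of_nonneg order_trans real_norm_def zero_le_power2)
    qed
  qed measurable
  have blk_mom: "(\<integral>x. (blk n x)\<^sup>2 \<partial>M) \<le> C * (real (2 * n + 1))\<^sup>2" for n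
  proof -
    have "(\<integral>x. (blk n x)\<^sup>2 \<partial>M) \<le> (\<integral>x. (\<Sum>i\<in>{n\<^sup>2..<(Suc n)\<^sup>2}. (d i x)\<^sup>2) * real (2 * n + 1) \<partial>M)"
      by (intro integral_mono blk_int bound_int blk_le)
    also have "\<dots> = (\<Sum>i\<in>{n\<^sup>2..<(Suc n)\<^sup>2}. \<integral>x. (d i x)\<^sup>2 \<partial>M) * real (2 * n + 1)"
      using int by (simp add: Bochner_Integration.integral_sum)
    also have "\<dots> \<le> (\<Sum>i\<in>{n\<^sup>2..<(Suc n)\<^sup>2}. C) * real (2 * n + 1)"
      by (intro mult_right_mono sum_mono bnd) auto
    also have "\<dots> = C * (real (2 * n + 1))\<^sup>2"
      by (simp only: sum_constant card) (simp add: power2_eq_square mult_ac)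
    finally show ?thesis .
  qed
  have S: "integrable M (\<lambda>x. (\<Sum>i<n. d i x)\<^sup>2) \<and> (\<integral>x. (\<Sum>i<n. d i x)\<^sup>2 \<partial>M) \<le> C * real n" for n
    by (rule second_moment_sum_orthogonal[OF meas int bnd orth])
  have Z_int: "integrable M (Z n)" for n
    unfolding Z_def power_divide using S[of "n\<^sup>2"] blk_int[of n] by (intro Bochner_Integration.integrable_add integrable_divide) auto
  \<comment> \<open>10 = 1 + 9: orthogonality gives C n^2 / n^4 for the average, and the 2 n + 1 <=
    3 n terms of a block give at most C (3 n)^2 / n^4.\<close>
  have Z_le: "(\<integral>x. Z n x \<partial>M) \<le> 10 * C * (1 / real n ^ 2)" for n
  proof (cases "n = 0")
    case False
    have "(\<integral>x. Z n x \<partial>M) = (\<integral>x. (\<Sum>i<n\<^sup>2. d i x)\<^sup>2 \<partial>M) / (real n ^ 2)\<^sup>2 + (\<integral>x. (blk n x)\<^sup>2 \<partial>M) / (real n ^ 2)\<^sup>2"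
      unfolding Z_def power_divide using S[of "n\<^sup>2"] blk_int[of n]
      by (subst Bochner_Integration.integral_add) (auto intro: integrable_divide)
    also have "\<dots> \<le> C * real (n\<^sup>2) / (real n ^ 2)\<^sup>2 + C * (real (2 * n + 1))\<^sup>2 / (real n ^ 2)\<^sup>2"
      using S[of "n\<^sup>2"] blk_mom[of n] by (intro add_mono divide_right_mono) auto
    also have "\<dots> \<le> C * real (n\<^sup>2) / (real n ^ 2)\<^sup>2 + C * (3 * real n)\<^sup>2 / (real n ^ 2)\<^sup>2"
      using False C by (intro add_mono divide_right_mono mult_left_mono power_mono order_refl) auto
    also have "\<dots> = 10 * C * (1 / real n ^ 2)"
      using False by (simp add: power2_eq_square field_simps)
    finally show ?thesis .
  qed (simp add: Z_def)
  have Z_nonneg: "0 \<le> (\<integral>x. Z n x \<partial>M)" for n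
    by (intro integral_nonneg_AE AE_I2) (simp add: Z_def)
  have "summable (\<lambda>n. \<integral>x. Z n x \<partial>M)"
  proof (rule summable_comparison_test')
    show "summable (\<lambda>n. 10 * C * (1 / real n ^ 2))"
      using inverse_power_summable[of 2] by (intro summable_mult) (simp add: inverse_eq_divide)
    show "norm (\<integral>x. Z n x \<partial>M) \<le> 10 * C * (1 / real n ^ 2)" if "0 \<le> n" for n
      using Z_le[of n] Z_nonneg[of n] by (simp only: real_norm_def abs_of_nonneg)
  qed
  then have "AE x in M. (\<lambda>n. Z n x) \<longlonglongrightarrow> 0"
    by (intro AE_tendsto_0_of_summable_integral Z_int) (simp add: Z_def)
  then show ?thesis
  proof eventually_elim
    case (elim x)
    have sq0: "f \<longlonglongrightarrow> 0" if "\<And>n. (f n)\<^sup>2 \<le> Z n x" for f :: "nat \<Rightarrow> real"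
    proof -
      have "(\<lambda>n. (f n)\<^sup>2) \<longlonglongrightarrow> 0"
        by (rule tendsto_sandwich[OF _ _ tendsto_const elim]) (use that in auto)
      then have "(\<lambda>n. sqrt ((f n)\<^sup>2)) \<longlonglongrightarrow> sqrt 0" by (rule tendsto_real_sqrt)
      then show ?thesis by (simp add: tendsto_rabs_zero_iff)
    qed
    have 1: "(\<lambda>n. \<bar>(\<Sum>i<n\<^sup>2. d i x) / real n ^ 2\<bar>) \<longlonglongrightarrow> 0"
      by (rule tendsto_rabs_zero, rule sq0) (simp add: Z_def)
    have 2: "(\<lambda>n. blk n x / real n ^ 2) \<longlonglongrightarrow> 0"
      by (rule sq0) (simp add: Z_def)
    have 3: "(\<lambda>n. \<bar>(\<Sum>i<n\<^sup>2. d i x) / real n ^ 2\<bar> + blk n x / real n ^ 2) \<longlonglongrightarrow> 0"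
      using tendsto_add[OF 1 2] by simp
    \<comment> \<open>\<open>floor_sqrt m\<close> selects the block between consecutive squares that
      contains m.\<close>
    have lim: "filterlim (\<lambda>m. floor_sqrt m) at_top sequentially"
      unfolding filterlim_at_top
    proof
      fix k :: nat
      show "\<forall>\<^sub>F m in sequentially. k \<le> floor_sqrt m"
        by (rule eventually_sequentiallyI[of "k\<^sup>2"]) (rule le_floor_sqrtI)
    qed
    show ?case
    proof (rule tendsto_rabs_zero_cancel, rule tendsto_sandwich[OF _ _ tendsto_const filterlim_compose[OF 3 lim]])
      show "\<forall>\<^sub>F m in sequentially. \<bar>(\<Sum>i<m. d i x) / real m\<bar>
          \<le> \<bar>(\<Sum>i<(floor_sqrt m)\<^sup>2. d i x) / real (floor_sqrt m) ^ 2\<bar> + blk (floor_sqrt m) x / real (floor_sqrt m) ^ 2"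
      proof (rule eventually_sequentiallyI[of 1])
        fix m :: nat assume m: "1 \<le> m"
        define n where "n = floor_sqrt m"
        have n: "n\<^sup>2 \<le> m" "m < (Suc n)\<^sup>2" "0 < n"
          using m Suc_floor_sqrt_power2_gt[of m] by (auto simp: n_def)
        have "(\<Sum>i<m. d i x) = (\<Sum>i<n\<^sup>2. d i x) + (\<Sum>i\<in>{n\<^sup>2..<m}. d i x)"
          using sum.atLeastLessThan_concat[of 0 "n\<^sup>2" m "\<lambda>i. d i x"] n(1)
          by (simp only: lessThan_atLeast0)
        moreover have "\<bar>\<Sum>i\<in>{n\<^sup>2..<m}. d i x\<bar> \<le> blk n x"
        proof -
          have "\<bar>\<Sum>i\<in>{n\<^sup>2..<m}. d i x\<bar> \<le> (\<Sum>i\<in>{n\<^sup>2..<m}. \<bar>d i x\<bar>)" by (rule sum_abs)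
          also have "\<dots> \<le> blk n x" unfolding blk_def using n by (intro sum_mono2) auto
          finally show ?thesis .
        qed
        ultimately have le: "\<bar>\<Sum>i<m. d i x\<bar> \<le> \<bar>\<Sum>i<n\<^sup>2. d i x\<bar> + blk n x" by linarith
        have "real n ^ 2 \<le> real m" using n by (metis of_nat_le_iff of_nat_power)
        then have "\<bar>(\<Sum>i<m. d i x) / real m\<bar> \<le> \<bar>\<Sum>i<m. d i x\<bar> / real n ^ 2"
          using n m by (auto intro!: divide_left_mono)
        also have "\<dots> \<le> (\<bar>\<Sum>i<n\<^sup>2. d i x\<bar> + blk n x) / real n ^ 2"
          using le by (intro divide_right_mono) auto
        finally show "\<bar>(\<Sum>i<m. d i x) / real m\<bar>
            \<le> \<bar>(\<Sum>i<(floor_sqrt m)\<^sup>2. d i x) / real (floor_sqrt m) ^ 2\<bar> + blk (floor_sqrt m) x / real (floor_sqrt m) ^ 2"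
          by (simp add: n_def add_divide_distrib)
      qed
    qed auto
  qed
qed

section \<open>Stability\<close>

lemma stable_poly_inverse_summable:
  fixes P :: "complex poly"
  assumes nz: "\<And>z. cmod z \<le> 1 \<Longrightarrow> poly P z \<noteq> 0"
  shows "summable (\<lambda>n. norm (fps_nth (inverse (fps_of_poly P)) n))"
proof -
  define R where "R = {z. poly P z = 0}"
  have "P \<noteq> 0" using nz[of 0] by auto
  then have fin: "finite R" unfolding R_def by (rule poly_roots_finite)
  \<comment> \<open>The roots are finitely many and lie outside the closed unit disc, so they keep a
    distance from it. The 2 keeps the set nonempty when there is no root.\<close>
  define r where "r = Min (insert 2 (cmod ` R))"
  have "1 < cmod z" if "z \<in> R" for z using nz[of z] that by (force simp: R_def)
  then have r: "1 < r" unfolding r_def using fin by (subst Min_gr_iff) auto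
  have "eval_fps (fps_of_poly P) z \<noteq> 0" if "ereal (norm z) < ereal r" for z
  proof
    assume "eval_fps (fps_of_poly P) z = 0"
    then have "r \<le> cmod z" unfolding r_def using fin by (intro Min_le) (auto simp: R_def)
    then show False using that by simp
  qed
  then have "min (ereal r) (fps_conv_radius (fps_of_poly P)) \<le> fps_conv_radius (inverse (fps_of_poly P))"
    by (rule fps_conv_radius_inverse)
  then have "ereal r \<le> fps_conv_radius (inverse (fps_of_poly P))" by simp
  moreover have "ereal (norm (1::complex)) < ereal r" using r by simp
  ultimately have "ereal (norm (1::complex)) < fps_conv_radius (inverse (fps_of_poly P))"
    by (rule order_less_le_trans[rotated])
  from norm_summable_fps[OF this] show ?thesis by simp
qed

text \<open>The solution of the recursion is the convolution of the forcing term with the coefficients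
  of \<open>1 / A(z)\<close>, which are summable because \<open>A\<close> has no zeros in a disc of radius larger than \<open>1\<close>.\<close>

lemma stable_recursion_convolution_bound:
  fixes a :: "nat \<Rightarrow> real"
  assumes stable: "\<And>z::complex. cmod z \<le> 1 \<Longrightarrow> 1 + (\<Sum>i=1..p. complex_of_real (a i) * z ^ i) \<noteq> 0"
  obtains g :: "nat \<Rightarrow> real" where "\<And>k. 0 \<le> g k" "summable g"
    "\<And>y v n. (\<And>n. y n = - (\<Sum>i=1..p. a i * neg0 y (int n - int i)) + v n) \<Longrightarrow>
      \<bar>y n\<bar> \<le> (\<Sum>k\<le>n. g k * \<bar>v (n - k)\<bar>)"
proof -
  define P :: "complex poly" where "P = [:1:] + (\<Sum>i=1..p. Polynomial.monom (complex_of_real (a i)) i)"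
  have polyP: "poly P z = 1 + (\<Sum>i=1..p. complex_of_real (a i) * z ^ i)" for z
    by (simp add: P_def poly_sum poly_monom)
  define f where "f = fps_of_poly P"
  define H where "H = inverse f"
  define g where "g k = norm (fps_nth H k)" for k
  have f_nth: "fps_nth f i = (if i = 0 then 1 else if i \<le> p then complex_of_real (a i) else 0)" for i
    by (auto simp: f_def P_def coeff_sum sum.delta' coeff_pCons split: nat.split)
  have Hf: "H * f = 1"
    unfolding H_def by (rule inverse_mult_eq_1) (simp add: f_nth)
  have "summable g"
    unfolding g_def H_def f_def by (rule stable_poly_inverse_summable) (use stable in \<open>simp only: polyP not_False_eq_True\<close>)
  moreover have "0 \<le> g k" for k by (simp add: g_def)
  moreover have "\<bar>y n\<bar> \<le> (\<Sum>k\<le>n. g k * \<bar>v (n - k)\<bar>)"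
    if rec: "\<And>n. y n = - (\<Sum>i=1..p. a i * neg0 y (int n - int i)) + v n" for y v :: "nat \<Rightarrow> real" and n
  proof -
    define Y where "Y = Abs_fps (\<lambda>n. complex_of_real (y n))"
    define V where "V = Abs_fps (\<lambda>n. complex_of_real (v n))"
    have "f * Y = V"
    proof (rule fps_ext)
      fix n
      have "fps_nth (f * Y) n = (\<Sum>i=0..n. fps_nth f i * complex_of_real (y (n - i)))"
        by (simp add: fps_mult_nth Y_def)
      also have "\<dots> = complex_of_real (y n) + (\<Sum>i=1..n. fps_nth f i * complex_of_real (y (n - i)))"
        by (simp add: sum.atLeast_Suc_atMost f_nth)
      \<comment> \<open>The two index ranges agree after discarding zeros: coefficients vanish
        beyond p, and \<open>neg0\<close> vanishes for lags beyond n.\<close>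
      also have "(\<Sum>i=1..n. fps_nth f i * complex_of_real (y (n - i)))
          = (\<Sum>i\<in>{1..n} \<inter> {1..p}. complex_of_real (a i) * complex_of_real (y (n - i)))"
        by (rule sum.mono_neutral_cong_right) (auto simp: f_nth)
      also have "\<dots> = (\<Sum>i\<in>{1..p}. complex_of_real (a i * neg0 y (int n - int i)))"
        by (rule sum.mono_neutral_cong_left) (auto simp: neg0_def nat_diff_distrib)
      also have "complex_of_real (y n) + \<dots> = complex_of_real (v n)"
        by (subst rec) simp
      finally show "fps_nth (f * Y) n = fps_nth V n" by (simp add: V_def)
    qed
    then have "Y = H * V" by (metis Hf mult.assoc mult_1)
    then have "complex_of_real (y n) = (\<Sum>k=0..n. fps_nth H k * complex_of_real (v (n - k)))"
      by (metis (no_types, lifting) Y_def V_def fps_mult_nth fps_nth_Abs_fps sum.cong)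
    then have "\<bar>y n\<bar> = norm (\<Sum>k=0..n. fps_nth H k * complex_of_real (v (n - k)))"
      by (metis norm_of_real)
    also have "\<dots> \<le> (\<Sum>k=0..n. norm (fps_nth H k * complex_of_real (v (n - k))))" by (rule norm_sum)
    also have "\<dots> = (\<Sum>k\<le>n. g k * \<bar>v (n - k)\<bar>)"
      by (simp add: g_def norm_mult atLeast0AtMost)
    finally show ?thesis .
  qed
  ultimately show ?thesis using that by blast
qed

text \<open>Cauchy-Schwarz with each weight split into two square roots, so that only the
  summability of g is used and the result is linear in the squares of v.\<close>

lemma convolution_sq_le:
  fixes g v :: "nat \<Rightarrow> real"
  assumes g: "\<And>k. 0 \<le> g k" and "summable g"
    and y: "\<bar>y\<bar> \<le> (\<Sum>k\<le>n. g k * \<bar>v (n - k)\<bar>)"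
  shows "y\<^sup>2 \<le> suminf g * (\<Sum>k\<le>n. g k * (v (n - k))\<^sup>2)"
proof -
  have "y\<^sup>2 \<le> (\<Sum>k\<le>n. sqrt (g k) * (sqrt (g k) * \<bar>v (n - k)\<bar>))\<^sup>2"
  proof -
    have "(\<Sum>k\<le>n. sqrt (g k) * (sqrt (g k) * \<bar>v (n - k)\<bar>)) = (\<Sum>k\<le>n. g k * \<bar>v (n - k)\<bar>)"
      using g by (simp flip: mult.assoc)
    then show ?thesis using y by (simp add: abs_le_square_iff[symmetric] order_trans[OF _ abs_ge_self])
  qed
  also have "\<dots> \<le> (\<Sum>k\<le>n. (sqrt (g k))\<^sup>2) * (\<Sum>k\<le>n. (sqrt (g k) * \<bar>v (n - k)\<bar>)\<^sup>2)"
    by (rule Cauchy_Schwarz_ineq_sum)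
  also have "\<dots> = (\<Sum>k\<le>n. g k) * (\<Sum>k\<le>n. g k * (v (n - k))\<^sup>2)"
    using g by (simp add: power_mult_distrib)
  also have "\<dots> \<le> suminf g * (\<Sum>k\<le>n. g k * (v (n - k))\<^sup>2)"
    using assms by (intro mult_right_mono sum_le_suminf sum_nonneg) auto
  finally show ?thesis .
qed

section \<open>Independence and the strong law for predictable weights\<close>

context prob_space
begin

text \<open>The sigma-algebra generated by the \<open>X i\<close> with i in K, pulled back from the
  product space, the form in which independence of disjoint blocks of variables is
  available.\<close>

abbreviation generated_algebra :: "('i \<Rightarrow> 'a \<Rightarrow> real) \<Rightarrow> 'i set \<Rightarrow> 'a measure" where
  "generated_algebra X K \<equiv>
    vimage_algebra (space M) (\<lambda>\<omega>. restrict (\<lambda>i. X i \<omega>) K) (PiM K (\<lambda>_. borel))"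

lemma restrict_measurable_generated:
  "(\<lambda>\<omega>. restrict (\<lambda>i. X i \<omega>) K) \<in> measurable (generated_algebra X K) (PiM K (\<lambda>_. borel))"
  by (rule measurable_vimage_algebra1) (auto simp: space_PiM)

lemma component_measurable_generated:
  assumes "i \<in> K"
  shows "X i \<in> borel_measurable (generated_algebra X K)"
proof -
  have "(\<lambda>\<omega>. restrict (\<lambda>i. X i \<omega>) K i) \<in> borel_measurable (generated_algebra X K)"
    by (rule measurable_compose[OF restrict_measurable_generated measurable_component_singleton[OF assms]])
  then show ?thesis using assms by simp
qed

lemma measurable_generated_mono:
  assumes f: "f \<in> measurable (generated_algebra X K) N" and "K \<subseteq> L"
  shows "f \<in> measurable (generated_algebra X L) N"
proof -
  have r: "(\<lambda>\<omega>. restrict (\<lambda>i. X i \<omega>) K) \<in> measurable (generated_algebra X L) (PiM K (\<lambda>_. borel))"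
    using \<open>K \<subseteq> L\<close> by (intro measurable_restrict component_measurable_generated) auto
  have "sigma_sets (space (generated_algebra X L))
      {(\<lambda>\<omega>. restrict (\<lambda>i. X i \<omega>) K) -` A \<inter> space M |A. A \<in> sets (PiM K (\<lambda>_. borel))} \<subseteq> sets (generated_algebra X L)"
    by (rule sets.sigma_sets_subset) (use measurable_sets[OF r] in auto)
  then have "sets (generated_algebra X K) \<subseteq> sets (generated_algebra X L)"
    by (simp add: sets_vimage_algebra[of _ _ "PiM K _"])
  then show ?thesis using f by (auto simp: measurable_def)
qed

text \<open>Disjoint blocks generate independent sigma-algebras, and Z and Y generate smaller ones.
  Only measurability is asked of Z and Y, not an explicit formula in terms of the X.\<close>

lemma indep_var_generated:
  fixes X :: "'i \<Rightarrow> 'a \<Rightarrow> real" and Y Z :: "'a \<Rightarrow> real"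
  assumes ind: "indep_vars (\<lambda>_. borel) X UNIV" and KL: "K \<inter> L = {}"
    and Z: "Z \<in> borel_measurable (generated_algebra X K)"
    and Y: "Y \<in> borel_measurable (generated_algebra X L)"
  shows "indep_var borel Z borel Y"
proof -
  have ind2: "indep_var (PiM K (\<lambda>_. borel)) (\<lambda>\<omega>. restrict (\<lambda>i. X i \<omega>) K)
      (PiM L (\<lambda>_. borel)) (\<lambda>\<omega>. restrict (\<lambda>i. X i \<omega>) L)"
    using KL by (intro indep_var_restrict[OF ind]) auto
  then have indep: "indep_set (sets (generated_algebra X K)) (sets (generated_algebra X L))"
    unfolding indep_var_eq sets_vimage_algebra by blast
  have sub: "sets (generated_algebra X I) \<subseteq> sets M" for I
  proof -
    have "(\<lambda>\<omega>. restrict (\<lambda>i. X i \<omega>) I) \<in> measurable M (PiM I (\<lambda>_. borel))"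
      using ind by (intro measurable_restrict) (auto simp: indep_vars_def)
    then show ?thesis
      unfolding sets_vimage_algebra by (intro sets.sigma_sets_subset) (auto dest: measurable_sets)
  qed
  have gen: "sigma_sets (space M) {V -` A \<inter> space M |A. A \<in> sets borel} \<subseteq> sets (generated_algebra X I)"
    if V: "V \<in> borel_measurable (generated_algebra X I)" for V :: "'a \<Rightarrow> real" and I
  proof -
    have "sigma_sets (space (generated_algebra X I)) {V -` A \<inter> space M |A. A \<in> sets borel} \<subseteq> sets (generated_algebra X I)"
      by (rule sets.sigma_sets_subset) (use measurable_sets[OF V] in auto)
    then show ?thesis by simp
  qed
  have "indep_set (sigma_sets (space M) {Z -` A \<inter> space M |A. A \<in> sets borel})
      (sigma_sets (space M) {Y -` A \<inter> space M |A. A \<in> sets borel})"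
    using indep unfolding indep_set_def
    by (rule indep_sets_mono_sets) (use gen[OF Z] gen[OF Y] in \<open>simp split: bool.split\<close>)
  moreover have "random_variable borel Z" "random_variable borel Y"
    using Z Y sub[of K] sub[of L] by (auto simp: measurable_def)
  ultimately show ?thesis unfolding indep_var_eq by blast
qed

lemma indep_var_past:
  fixes X :: "'i \<Rightarrow> 'a \<Rightarrow> real" and Z :: "'a \<Rightarrow> real"
  assumes "indep_vars (\<lambda>_. borel) X UNIV" and "k \<notin> K" and "Z \<in> borel_measurable (generated_algebra X K)"
  shows "indep_var borel Z borel (X k)"
  using assms(2)
  by (intro indep_var_generated[OF assms(1) _ assms(3) component_measurable_generated[of k "{k}"]]) auto

text \<open>\<open>K n\<close> indexes what is known at time n and \<open>\<kappa> n\<close> the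
  noise arriving at time n. The weight \<open>Z i\<close> is independent of the next noise variable,
  which has mean 0 and second moment 1, so the products are orthogonal with the second moments of
  the weights.\<close>

lemma strong_law_predictable:
  fixes X :: "'i \<Rightarrow> 'a \<Rightarrow> real" and Z :: "nat \<Rightarrow> 'a \<Rightarrow> real"
  assumes ind: "indep_vars (\<lambda>_. borel) X UNIV"
    and K: "\<And>n. K n \<subseteq> K (Suc n)" "\<And>n. \<kappa> n \<in> K n" "\<And>n. \<kappa> (Suc n) \<notin> K n"
    and Z: "\<And>n. Z n \<in> borel_measurable (generated_algebra X (K n))"
    and Z_sq: "\<And>n. integrable M (\<lambda>\<omega>. (Z n \<omega>)\<^sup>2)" "\<And>n. expectation (\<lambda>\<omega>. (Z n \<omega>)\<^sup>2) \<le> C"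
    and X_sq: "\<And>n. integrable M (\<lambda>\<omega>. (X (\<kappa> n) \<omega>)\<^sup>2)" "\<And>n. expectation (\<lambda>\<omega>. (X (\<kappa> n) \<omega>)\<^sup>2) = 1"
    and X_mean: "\<And>n. expectation (X (\<kappa> n)) = 0"
  shows "AE \<omega> in M. (\<lambda>n. (\<Sum>i<n. Z i \<omega> * X (\<kappa> (Suc i)) \<omega>) / real n) \<longlonglongrightarrow> 0"
proof -
  have K_mono: "K m \<subseteq> K n" if "m \<le> n" for m n
    using K(1) that by (rule lift_Suc_mono_le)
  have Xm[measurable]: "X i \<in> borel_measurable M" for i
    using ind by (simp add: indep_vars_def)
  have Zm[measurable]: "Z n \<in> borel_measurable M" for n
    using indep_var_past[OF ind K(3) Z[of n]] by (simp add: indep_var_eq)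
  have X_int: "integrable M (X (\<kappa> n))" for n
    by (rule square_integrable_imp_integrable[OF Xm X_sq(1)])
  have sq: "integrable M (\<lambda>\<omega>. (Z n \<omega> * X (\<kappa> (Suc n)) \<omega>)\<^sup>2) \<and>
    expectation (\<lambda>\<omega>. (Z n \<omega> * X (\<kappa> (Suc n)) \<omega>)\<^sup>2) = expectation (\<lambda>\<omega>. (Z n \<omega>)\<^sup>2)" for n
  proof -
    have "indep_var borel ((\<lambda>x. x\<^sup>2) \<circ> Z n) borel ((\<lambda>x. x\<^sup>2) \<circ> X (\<kappa> (Suc n)))"
      by (rule indep_var_compose[OF indep_var_past[OF ind K(3) Z]]) auto
    then have iv: "indep_var borel (\<lambda>\<omega>. (Z n \<omega>)\<^sup>2) borel (\<lambda>\<omega>. (X (\<kappa> (Suc n)) \<omega>)\<^sup>2)"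
      by (simp add: o_def)
    show ?thesis
      using indep_var_integrable[OF iv Z_sq(1) X_sq(1)] indep_var_lebesgue_integral[OF iv Z_sq(1) X_sq(1)]
      by (simp add: power_mult_distrib X_sq(2))
  qed
  show ?thesis
  proof (rule strong_law_orthogonal)
    show "(\<lambda>\<omega>. Z n \<omega> * X (\<kappa> (Suc n)) \<omega>) \<in> borel_measurable M" for n by measurable
    show "integrable M (\<lambda>\<omega>. (Z n \<omega> * X (\<kappa> (Suc n)) \<omega>)\<^sup>2)" for n using sq by blast
    show "expectation (\<lambda>\<omega>. (Z n \<omega> * X (\<kappa> (Suc n)) \<omega>)\<^sup>2) \<le> C" for n using sq Z_sq(2) by simp
    fix i j :: nat assume "i < j"
    \<comment> \<open>All factors except the latest noise variable; they are known at time j, so the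
      expectation factorises with a factor 0.\<close>
    define f where "f \<omega> = (Z i \<omega> * X (\<kappa> (Suc i)) \<omega>) * Z j \<omega>" for \<omega>
    have "\<kappa> (Suc i) \<in> K j" using K_mono[of "Suc i" j] K(2)[of "Suc i"] \<open>i < j\<close> by auto
    then have "f \<in> borel_measurable (generated_algebra X (K j))"
      unfolding f_def using measurable_generated_mono[OF Z[of i] K_mono[of i j]] Z[of j] \<open>i < j\<close>
      by (intro borel_measurable_times component_measurable_generated) auto
    then have iv: "indep_var borel f borel (X (\<kappa> (Suc j)))"
      by (rule indep_var_past[OF ind K(3)])
    have "integrable M f"
      unfolding f_def using sq Z_sq(1) by (intro integrable_mult_of_squares) auto
    from indep_var_lebesgue_integral[OF iv this X_int]
    show "expectation (\<lambda>\<omega>. Z i \<omega> * X (\<kappa> (Suc i)) \<omega> * (Z j \<omega> * X (\<kappa> (Suc j)) \<omega>)) = 0"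
      by (simp add: f_def X_mean mult_ac)
  qed
qed

section \<open>Moments of the noise and boundedness of the input\<close>

lemma std_normal_moments:
  assumes D: "distributed M lborel W (\<lambda>x. ennreal (std_normal_density x))"
  shows "integrable M (\<lambda>\<omega>. W \<omega> ^ k)" "expectation W = 0"
    "expectation (\<lambda>\<omega>. (W \<omega>)\<^sup>2) = 1" "expectation (\<lambda>\<omega>. W \<omega> ^ 4) = 3"
proof -
  show "integrable M (\<lambda>\<omega>. W \<omega> ^ k)"
    using distributed_integrable[OF D, of "\<lambda>x. x ^ k"] integrable_std_normal_moment[of k] by simp
  show "expectation W = 0"
    using distributed_integral[OF D, of "\<lambda>x. x"] integral_std_normal_moment_odd[of 0] by simp
  show "expectation (\<lambda>\<omega>. (W \<omega>)\<^sup>2) = 1"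
    using distributed_integral[OF D, of "\<lambda>x. x\<^sup>2"] integral_std_normal_moment_even[of 1] by simp
  show "expectation (\<lambda>\<omega>. W \<omega> ^ 4) = 3"
    using distributed_integral[OF D, of "\<lambda>x. x ^ 4"] integral_std_normal_moment_even[of 2]
    by (simp add: fact_numeral)
qed

lemma std_normal_energy:
  fixes X :: "'i \<Rightarrow> 'a \<Rightarrow> real" and \<kappa> :: "nat \<Rightarrow> 'i"
  assumes ind: "indep_vars (\<lambda>_. borel) X UNIV" and inj: "inj \<kappa>"
    and X: "\<And>n. distributed M lborel (X (\<kappa> n)) (\<lambda>x. ennreal (std_normal_density x))"
  shows "AE \<omega> in M. \<forall>\<^sub>F n in sequentially. (\<Sum>i<n. (X (\<kappa> i) \<omega>)\<^sup>2) \<le> 2 * real n"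
proof -
  define W where "W n = X (\<kappa> n)" for n
  have D: "distributed M lborel (W n) (\<lambda>x. ennreal (std_normal_density x))" for n
    using X by (simp add: W_def)
  note mom = std_normal_moments[OF D]
  have Wm[measurable]: "W n \<in> borel_measurable M" for n
    using D[of n] by (simp add: distributed_def)
  have W2: "integrable M (\<lambda>\<omega>. (W n \<omega>)\<^sup>2 - 1)" "expectation (\<lambda>\<omega>. (W n \<omega>)\<^sup>2 - 1) = 0" for n
    using mom(1)[of n 2] mom(3)[of n] by (simp_all add: prob_space)
  have expand: "((W n \<omega>)\<^sup>2 - 1)\<^sup>2 = W n \<omega> ^ 4 - 2 * (W n \<omega>)\<^sup>2 + 1" for n \<omega>
    by (simp add: power2_diff flip: power_mult)
  have "AE \<omega> in M. (\<lambda>n. (\<Sum>i<n. (W i \<omega>)\<^sup>2 - 1) / real n) \<longlonglongrightarrow> 0"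
  proof (rule strong_law_orthogonal)
    show "(\<lambda>\<omega>. (W n \<omega>)\<^sup>2 - 1) \<in> borel_measurable M" for n by measurable
    show "integrable M (\<lambda>\<omega>. ((W n \<omega>)\<^sup>2 - 1)\<^sup>2)" for n
      unfolding expand using mom(1)[of n 2] mom(1)[of n 4] by simp
    \<comment> \<open>From the fourth and second moments: 3 - 2 + 1 = 2.\<close>
    show "expectation (\<lambda>\<omega>. ((W n \<omega>)\<^sup>2 - 1)\<^sup>2) \<le> 2" for n
      unfolding expand using mom(1)[of n 2] mom(1)[of n 4] mom(3,4)[of n] by (simp add: prob_space)
    fix i j :: nat assume "i < j"
    have adapted: "(\<lambda>\<omega>. (W k \<omega>)\<^sup>2 - 1) \<in> borel_measurable (generated_algebra X {\<kappa> k})" for k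
      unfolding W_def by (intro borel_measurable_diff borel_measurable_power component_measurable_generated) auto
    have iv: "indep_var borel (\<lambda>\<omega>. (W i \<omega>)\<^sup>2 - 1) borel (\<lambda>\<omega>. (W j \<omega>)\<^sup>2 - 1)"
      using \<open>i < j\<close> inj by (intro indep_var_generated[OF ind _ adapted adapted]) (auto dest: injD)
    show "expectation (\<lambda>\<omega>. ((W i \<omega>)\<^sup>2 - 1) * ((W j \<omega>)\<^sup>2 - 1)) = 0"
      using indep_var_lebesgue_integral[OF iv W2(1) W2(1)] by (simp add: W2(2))
  qed
  then have "AE \<omega> in M. \<forall>\<^sub>F n in sequentially. (\<Sum>i<n. (W i \<omega>)\<^sup>2) \<le> 2 * real n"
  proof eventually_elim
    case (elim \<omega>)
    have "\<forall>\<^sub>F n in sequentially. (\<Sum>i<n. (W i \<omega>)\<^sup>2 - 1) / real n < 1"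
      by (rule order_tendstoD(2)[OF elim]) simp
    with eventually_gt_at_top[of 0] show ?case
    proof eventually_elim
      case (elim n)
      then show ?case by (simp add: sum_subtractf field_simps)
    qed
  qed
  then show ?thesis by (simp only: W_def)
qed

lemma uniform_AE_bounded:
  assumes "distributed M lborel U (\<lambda>x. ennreal (indicator {-\<delta>..\<delta>} x / (2 * \<delta>)))"
  shows "AE \<omega> in M. \<bar>U \<omega>\<bar> \<le> \<delta>"
proof -
  have Um: "U \<in> measurable M lborel" and m: "(\<lambda>x. ennreal (indicator {-\<delta>..\<delta>} x / (2 * \<delta>))) \<in> borel_measurable lborel"
    and eq: "distr M lborel U = density lborel (\<lambda>x. ennreal (indicator {-\<delta>..\<delta>} x / (2 * \<delta>)))"
    using assms by (auto simp: distributed_def)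
  have "AE x in distr M lborel U. \<bar>x\<bar> \<le> \<delta>"
    unfolding eq by (subst AE_density[OF m]) (auto simp: indicator_def split: if_splits)
  then show ?thesis by (subst (asm) AE_distr_iff[OF Um]) auto
qed

end

section \<open>The quantized system\<close>

lemma quant_error:
  assumes "0 < eps"
  shows "\<bar>quant eps x - x\<bar> \<le> eps / 2"
proof -
  have "x / eps - 1/2 \<le> real_of_int \<lfloor>x / eps + 1/2\<rfloor>" "real_of_int \<lfloor>x / eps + 1/2\<rfloor> \<le> x / eps + 1/2"
    by linarith+
  then have "eps * (x / eps - 1/2) \<le> quant eps x" "quant eps x \<le> eps * (x / eps + 1/2)"
    unfolding quant_def using assms by (intro mult_left_mono; simp)+
  then have "x - quant eps x \<le> eps / 2" "quant eps x - x \<le> eps / 2"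
    using assms by (simp_all add: algebra_simps)
  then show ?thesis by linarith
qed

lemma quant_measurable[measurable]: "quant eps \<in> borel_measurable borel"
  unfolding quant_def by measurable

text \<open>Built with \<open>nonpos0\<close>, as the regressors are, whereas the system uses
  \<open>neg0\<close>. The two conventions differ only in the values at time 0.\<close>

definition arx_regression ::
    "(nat \<Rightarrow> real) \<Rightarrow> (nat \<Rightarrow> real) \<Rightarrow> nat \<Rightarrow> nat \<Rightarrow> (nat \<Rightarrow> real) \<Rightarrow> (nat \<Rightarrow> real) \<Rightarrow> nat \<Rightarrow> real" where
  "arx_regression a b p q s u i = - (\<Sum>k=1..p. a k * nonpos0 s (int i + 1 - int k))
    + (\<Sum>k=1..q. b k * nonpos0 u (int i + 1 - int k))"

text \<open>Zero coefficients beyond the true orders make the prediction the same for every p >= p0,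
  so one function R serves all these orders.\<close>

lemma theta_bar_regression:
  assumes a: "\<And>i. p0 < i \<Longrightarrow> a i = 0" and b: "\<And>j. q0 < j \<Longrightarrow> b j = 0"
    and "p0 \<le> p" "q0 \<le> q"
  shows "(\<Sum>j<p + q. theta_bar a b p q $ j * psi s u p q i $ j) = arx_regression a b p0 q0 s u i"
proof -
  have "(\<Sum>j<p + q. theta_bar a b p q $ j * psi s u p q i $ j) =
      (\<Sum>j<p. - (a (Suc j) * nonpos0 s (int i + 1 - int (Suc j))))
      + (\<Sum>j<q. b (Suc j) * nonpos0 u (int i + 1 - int (Suc j)))"
    unfolding sum_lessThan_add by (intro arg_cong2[where f = "(+)"] sum.cong) (auto simp: theta_bar_def psi_def)
  also have "(\<Sum>j<p. - (a (Suc j) * nonpos0 s (int i + 1 - int (Suc j)))) =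
      - (\<Sum>k=1..p. a k * nonpos0 s (int i + 1 - int k))"
    unfolding sum_negf by (simp only: sum.atLeast1_atMost_eq One_nat_def)
  also have "(\<Sum>k=1..p. a k * nonpos0 s (int i + 1 - int k)) = (\<Sum>k=1..p0. a k * nonpos0 s (int i + 1 - int k))"
    using assms by (intro sum.mono_neutral_right) auto
  also have "(\<Sum>j<q. b (Suc j) * nonpos0 u (int i + 1 - int (Suc j))) =
      (\<Sum>k=1..q. b k * nonpos0 u (int i + 1 - int k))"
    by (simp only: sum.atLeast1_atMost_eq One_nat_def)
  also have "\<dots> = (\<Sum>k=1..q0. b k * nonpos0 u (int i + 1 - int k))"
    using assms by (intro sum.mono_neutral_right) auto
  finally show ?thesis by (simp add: arx_regression_def)
qed

text \<open>For i >= p and i >= q every lagged time is at least 1, so both conventions for early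
  times agree. Then eps / 2 comes from the new output and c eps / 2 from each of the p lagged
  outputs; the inputs are not quantized.\<close>

lemma arx_residual_bound:
  assumes sys: "y (Suc i) = - (\<Sum>k=1..p. a k * neg0 y (int i + 1 - int k))
      + (\<Sum>j=1..q. b j * neg0 u (int i + 1 - int j)) + w"
    and i: "p \<le> i" "q \<le> i" and eps: "0 < eps" and a: "\<And>k. 1 \<le> k \<Longrightarrow> k \<le> p \<Longrightarrow> \<bar>a k\<bar> \<le> c"
  shows "\<bar>quant eps (y (Suc i)) - arx_regression a b p q (\<lambda>n. quant eps (y n)) u i - w\<bar>
    \<le> (1 + real p * c) * eps / 2"
proof -
  define e where "e n = quant eps (y n) - y n" for n
  have e: "\<bar>e n\<bar> \<le> eps / 2" for n unfolding e_def by (rule quant_error[OF eps])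
  have "(\<Sum>k=1..p. a k * nonpos0 (\<lambda>n. quant eps (y n)) (int i + 1 - int k)) =
      (\<Sum>k=1..p. a k * neg0 y (int i + 1 - int k) + a k * e (nat (int i + 1 - int k)))"
    using i by (intro sum.cong) (auto simp: nonpos0_def neg0_def e_def algebra_simps)
  moreover have "(\<Sum>j=1..q. b j * nonpos0 u (int i + 1 - int j)) = (\<Sum>j=1..q. b j * neg0 u (int i + 1 - int j))"
    using i by (intro sum.cong) (auto simp: nonpos0_def neg0_def)
  moreover have "quant eps (y (Suc i)) = y (Suc i) + e (Suc i)" by (simp add: e_def)
  ultimately have "quant eps (y (Suc i)) - arx_regression a b p q (\<lambda>n. quant eps (y n)) u i - w =
      e (Suc i) + (\<Sum>k=1..p. a k * e (nat (int i + 1 - int k)))"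
    using sys by (simp add: arx_regression_def sum.distrib)
  also have "\<bar>\<dots>\<bar> \<le> eps / 2 + (\<Sum>k=1..p. c * (eps / 2))"
  proof (rule order_trans[OF abs_triangle_ineq add_mono])
    show "\<bar>\<Sum>k=1..p. a k * e (nat (int i + 1 - int k))\<bar> \<le> (\<Sum>k=1..p. c * (eps / 2))"
    proof (rule order_trans[OF sum_abs sum_mono])
      fix k assume "k \<in> {1..p}"
      then have "\<bar>a k\<bar> \<le> c" using a by simp
      then show "\<bar>a k * e (nat (int i + 1 - int k))\<bar> \<le> c * (eps / 2)"
        unfolding abs_mult using e by (intro mult_mono) auto
    qed
  qed (rule e)
  finally show ?thesis by (simp add: field_simps)
qed

lemma neg0_measurable:
  fixes f :: "nat \<Rightarrow> 'a \<Rightarrow> real"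
  assumes "0 \<le> k \<Longrightarrow> f (nat k) \<in> borel_measurable M"
  shows "(\<lambda>\<omega>. neg0 (\<lambda>i. f i \<omega>) k) \<in> borel_measurable M"
  using assms by (cases "k < 0") (auto simp: neg0_def)

lemma nonpos0_measurable:
  fixes f :: "nat \<Rightarrow> 'a \<Rightarrow> real"
  assumes "0 < k \<Longrightarrow> f (nat k) \<in> borel_measurable M"
  shows "(\<lambda>\<omega>. nonpos0 (\<lambda>i. f i \<omega>) k) \<in> borel_measurable M"
  using assms by (cases "k \<le> 0") (auto simp: nonpos0_def)

lemma (in prob_space) second_moment_nonpos0:
  fixes f :: "nat \<Rightarrow> 'a \<Rightarrow> real"
  assumes "\<And>n. integrable M (\<lambda>\<omega>. (f n \<omega>)\<^sup>2)" and bnd: "\<And>n. expectation (\<lambda>\<omega>. (f n \<omega>)\<^sup>2) \<le> C"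
  shows "integrable M (\<lambda>\<omega>. (nonpos0 (\<lambda>i. f i \<omega>) k)\<^sup>2)"
    and "expectation (\<lambda>\<omega>. (nonpos0 (\<lambda>i. f i \<omega>) k)\<^sup>2) \<le> C"
proof -
  have "0 \<le> expectation (\<lambda>\<omega>. (f 0 \<omega>)\<^sup>2)" by (intro integral_nonneg_AE) simp
  then have "0 \<le> C" using bnd[of 0] by linarith
  then show "integrable M (\<lambda>\<omega>. (nonpos0 (\<lambda>i. f i \<omega>) k)\<^sup>2)"
    "expectation (\<lambda>\<omega>. (nonpos0 (\<lambda>i. f i \<omega>) k)\<^sup>2) \<le> C"
    using assms by (cases "k \<le> 0"; simp add: nonpos0_def)+
qed

lemma (in prob_space) second_moment_of_AE_bound:
  fixes f g :: "'a \<Rightarrow> real"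
  assumes "f \<in> borel_measurable M" "integrable M g" "AE \<omega> in M. (f \<omega>)\<^sup>2 \<le> g \<omega>"
  shows "integrable M (\<lambda>\<omega>. (f \<omega>)\<^sup>2)" "expectation (\<lambda>\<omega>. (f \<omega>)\<^sup>2) \<le> expectation g"
proof -
  show 1: "integrable M (\<lambda>\<omega>. (f \<omega>)\<^sup>2)"
    using assms(1,3) by (intro Bochner_Integration.integrable_bound[OF assms(2)]) auto
  show "expectation (\<lambda>\<omega>. (f \<omega>)\<^sup>2) \<le> expectation g"
    by (rule integral_mono_AE[OF 1 assms(2,3)])
qed

locale arx_system = prob_space M for M :: "'w measure" +
  fixes w u y :: "nat \<Rightarrow> 'w \<Rightarrow> real" and a b :: "nat \<Rightarrow> real" and p0 q0 :: nat and \<delta> :: real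
  assumes w_distr: "\<And>n. distributed M lborel (w n) (\<lambda>x. ennreal (std_normal_density x))"
    and u_distr: "\<And>n. distributed M lborel (u n)
      (\<lambda>x. ennreal (indicator {-\<delta>..\<delta>} x / (2 * \<delta>)))"
    and indep: "indep_vars (\<lambda>_. borel) (\<lambda>k. case k of Inl n \<Rightarrow> w n | Inr n \<Rightarrow> u n) UNIV"
    and y0: "\<And>\<omega>. y 0 \<omega> = w 0 \<omega>"
    and sys: "\<And>n \<omega>. y (Suc n) \<omega> =
      - (\<Sum>i=1..p0. a i * neg0 (\<lambda>k. y k \<omega>) (int n + 1 - int i))
      + (\<Sum>j=1..q0. b j * neg0 (\<lambda>k. u k \<omega>) (int n + 1 - int j)) + w (Suc n) \<omega>"
    and stable: "\<And>z::complex. cmod z \<le> 1 \<Longrightarrow> 1 + (\<Sum>i=1..p0. complex_of_real (a i) * z ^ i) \<noteq> 0"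
begin

definition "X k = (case k of Inl n \<Rightarrow> w n | Inr n \<Rightarrow> u n)"

text \<open>Contains the input at time n, which enters the regressor at time n, but not the noise at
  time n + 1.\<close>

definition past :: "nat \<Rightarrow> (nat + nat) set" where
  "past n = Inl ` {..n} \<union> Inr ` {..n}"

lemma indep_X: "indep_vars (\<lambda>_. borel) X UNIV"
  using indep by (simp add: X_def[abs_def])

lemma w_adapted: "i \<le> n \<Longrightarrow> w i \<in> borel_measurable (generated_algebra X (past n))"
  using component_measurable_generated[of "Inl i" "past n" X] by (simp add: X_def past_def)

lemma u_adapted: "i \<le> n \<Longrightarrow> u i \<in> borel_measurable (generated_algebra X (past n))"
  using component_measurable_generated[of "Inr i" "past n" X] by (simp add: X_def past_def)

lemma y_adapted: "i \<le> n \<Longrightarrow> y i \<in> borel_measurable (generated_algebra X (past n))"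
proof (induction i rule: less_induct)
  case (less i)
  show ?case
  proof (cases i)
    case 0
    then have eq: "y i = w 0" by (simp add: fun_eq_iff y0)
    show ?thesis unfolding eq by (rule w_adapted) simp
  next
    case (Suc m)
    have "(\<lambda>\<omega>. - (\<Sum>i=1..p0. a i * neg0 (\<lambda>k. y k \<omega>) (int m + 1 - int i))
        + (\<Sum>j=1..q0. b j * neg0 (\<lambda>k. u k \<omega>) (int m + 1 - int j)) + w (Suc m) \<omega>)
        \<in> borel_measurable (generated_algebra X (past n))"
      using less Suc
      by (intro borel_measurable_add borel_measurable_uminus borel_measurable_sum borel_measurable_times
          borel_measurable_const neg0_measurable less.IH u_adapted w_adapted) auto
    moreover have "y i = (\<lambda>\<omega>. - (\<Sum>i=1..p0. a i * neg0 (\<lambda>k. y k \<omega>) (int m + 1 - int i))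
        + (\<Sum>j=1..q0. b j * neg0 (\<lambda>k. u k \<omega>) (int m + 1 - int j)) + w (Suc m) \<omega>)"
      unfolding Suc by (rule ext) (rule sys)
    ultimately show ?thesis by (simp only:)
  qed
qed

text \<open>Independence from a noise variable outside \<open>past n\<close> includes measurability
  on M, which is all that is extracted.\<close>

lemma generated_subset_measurable:
  fixes f :: "'w \<Rightarrow> real"
  assumes "f \<in> borel_measurable (generated_algebra X (past n))"
  shows "f \<in> borel_measurable M"
proof -
  have "Inl (Suc n) \<notin> past n" by (auto simp: past_def)
  from indep_var_past[OF indep_X this assms] show ?thesis by (simp only: indep_var_eq)
qed

text \<open>The forcing is the bounded input part plus w, with second moments at most 2 + 2 D^2; the
  convolution bound multiplies this by the square of the sum of g.\<close>

lemma y_second_moment: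
  obtains C where "\<And>n. integrable M (\<lambda>\<omega>. (y n \<omega>)\<^sup>2)" "\<And>n. expectation (\<lambda>\<omega>. (y n \<omega>)\<^sup>2) \<le> C"
proof -
  obtain g :: "nat \<Rightarrow> real" where g: "\<And>k. 0 \<le> g k" "summable g"
    "\<And>y v n. (\<And>n. y n = - (\<Sum>i=1..p0. a i * neg0 y (int n - int i)) + v n) \<Longrightarrow>
      \<bar>y n\<bar> \<le> (\<Sum>k\<le>n. g k * \<bar>v (n - k)\<bar>)"
    using stable_recursion_convolution_bound[OF stable] by blast
  define v where "v \<omega> n = (\<Sum>j=1..q0. b j * neg0 (\<lambda>k. u k \<omega>) (int n - int j)) + w n \<omega>" for \<omega> n
  define D where "D = (\<Sum>j=1..q0. \<bar>b j\<bar> * \<bar>\<delta>\<bar>)"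
  define B where "B n \<omega> = suminf g * (\<Sum>k\<le>n. g k * (2 * (w (n - k) \<omega>)\<^sup>2 + 2 * D\<^sup>2))" for n \<omega>
  \<comment> \<open>One recursion for all n: at n = 0 every lag is negative, so it reduces to the
    initial value w 0.\<close>
  have rec: "y n \<omega> = - (\<Sum>i=1..p0. a i * neg0 (\<lambda>k. y k \<omega>) (int n - int i)) + v \<omega> n" for n \<omega>
  proof (cases n)
    case 0
    have "(\<Sum>i=1..p0. a i * neg0 (\<lambda>k. y k \<omega>) (int n - int i)) = 0"
      "(\<Sum>j=1..q0. b j * neg0 (\<lambda>k. u k \<omega>) (int n - int j)) = 0"
      using 0 by (auto intro!: sum.neutral simp: neg0_def)
    then show ?thesis using 0 by (simp add: v_def y0)
  next
    case (Suc m)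
    then show ?thesis using sys[of m \<omega>] by (simp add: v_def add.commute)
  qed
  have ysq: "(y n \<omega>)\<^sup>2 \<le> suminf g * (\<Sum>k\<le>n. g k * (v \<omega> (n - k))\<^sup>2)" for n \<omega>
    by (rule convolution_sq_le[OF g(1,2) g(3)]) (rule rec)
  have "AE \<omega> in M. \<forall>n. \<bar>u n \<omega>\<bar> \<le> \<delta>"
    unfolding AE_all_countable using uniform_AE_bounded[OF u_distr] by blast
  then have y_le: "AE \<omega> in M. (y n \<omega>)\<^sup>2 \<le> B n \<omega>" for n
  proof eventually_elim
    case (elim \<omega>)
    have v_le: "(v \<omega> k)\<^sup>2 \<le> 2 * (w k \<omega>)\<^sup>2 + 2 * D\<^sup>2" for k
    proof -
      define S where "S = (\<Sum>j=1..q0. b j * neg0 (\<lambda>k. u k \<omega>) (int k - int j))"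
      have "\<bar>S\<bar> \<le> D"
        unfolding S_def D_def
      proof (rule order_trans[OF sum_abs sum_mono])
        fix j assume "j \<in> {1..q0}"
        have "\<bar>neg0 (\<lambda>k. u k \<omega>) (int k - int j)\<bar> \<le> \<bar>\<delta>\<bar>"
          using elim by (auto simp: neg0_def intro: order_trans[OF _ abs_ge_self])
        then show "\<bar>b j * neg0 (\<lambda>k. u k \<omega>) (int k - int j)\<bar> \<le> \<bar>b j\<bar> * \<bar>\<delta>\<bar>"
          unfolding abs_mult by (intro mult_left_mono) auto
      qed
      then have "S\<^sup>2 \<le> D\<^sup>2" by (metis abs_ge_zero power2_abs power_mono)
      moreover have "(S + w k \<omega>)\<^sup>2 \<le> 2 * (w k \<omega>)\<^sup>2 + 2 * S\<^sup>2"
        using sum_squares_bound[of S "w k \<omega>"] by (simp add: power2_sum)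
      ultimately show ?thesis by (simp add: v_def S_def)
    qed
    have "0 \<le> suminf g" using g by (intro suminf_nonneg) auto
    then have "suminf g * (\<Sum>k\<le>n. g k * (v \<omega> (n - k))\<^sup>2) \<le> B n \<omega>"
      unfolding B_def using g(1) by (intro mult_left_mono sum_mono v_le) auto
    then show ?case using ysq[of n \<omega>] by linarith
  qed
  note w_mom = std_normal_moments[OF w_distr]
  have B_int: "integrable M (B n)" for n
    unfolding B_def using w_mom(1)[of _ 2] by simp
  have B_le: "expectation (B n) \<le> suminf g * (suminf g * (2 + 2 * D\<^sup>2))" for n
  proof -
    have "expectation (B n) = suminf g * (\<Sum>k\<le>n. g k * (2 + 2 * D\<^sup>2))"
      unfolding B_def using w_mom(1)[of _ 2] w_mom(3) by (simp add: prob_space)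
    also have "(\<Sum>k\<le>n. g k * (2 + 2 * D\<^sup>2)) = (\<Sum>k\<le>n. g k) * (2 + 2 * D\<^sup>2)"
      by (simp add: sum_distrib_right)
    also have "suminf g * \<dots> \<le> suminf g * (suminf g * (2 + 2 * D\<^sup>2))"
      using g by (intro mult_left_mono mult_right_mono sum_le_suminf suminf_nonneg) auto
    finally show ?thesis .
  qed
  have ym: "y n \<in> borel_measurable M" for n
    using generated_subset_measurable[OF y_adapted[OF order_refl]] .
  show ?thesis
    using second_moment_of_AE_bound[OF ym B_int y_le] B_le that by (meson order_trans)
qed

lemma strong_law_lagged:
  fixes f :: "nat \<Rightarrow> 'w \<Rightarrow> real"
  assumes "\<And>i n. i \<le> n \<Longrightarrow> f i \<in> borel_measurable (generated_algebra X (past n))"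
    and f: "\<And>n. integrable M (\<lambda>\<omega>. (f n \<omega>)\<^sup>2)" "\<And>n. expectation (\<lambda>\<omega>. (f n \<omega>)\<^sup>2) \<le> C"
  shows "AE \<omega> in M. (\<lambda>n. (\<Sum>i<n. nonpos0 (\<lambda>m. f m \<omega>) (int i - int k) * w (Suc i) \<omega>) / real n) \<longlonglongrightarrow> 0"
proof -
  have "AE \<omega> in M. (\<lambda>n. (\<Sum>i<n. nonpos0 (\<lambda>m. f m \<omega>) (int i - int k) * X (Inl (Suc i)) \<omega>) / real n) \<longlonglongrightarrow> 0"
  proof (rule strong_law_predictable[OF indep_X, where K = past and \<kappa> = Inl and C = C])
    show "(\<lambda>\<omega>. nonpos0 (\<lambda>m. f m \<omega>) (int n - int k)) \<in> borel_measurable (generated_algebra X (past n))" for n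
      using assms(1) by (intro nonpos0_measurable) auto
    show "integrable M (\<lambda>\<omega>. (nonpos0 (\<lambda>m. f m \<omega>) (int n - int k))\<^sup>2)" for n
      by (rule second_moment_nonpos0[OF f])
    show "expectation (\<lambda>\<omega>. (nonpos0 (\<lambda>m. f m \<omega>) (int n - int k))\<^sup>2) \<le> C" for n
      by (rule second_moment_nonpos0[OF f])
  qed (auto simp: X_def past_def std_normal_moments[OF w_distr])
  then show ?thesis by (simp add: X_def)
qed

text \<open>Each coordinate is a lagged quantized output or a lagged input. Quantization moves an
  output by at most eps / 2, so second moments stay bounded.\<close>

lemma psi_noise_average:
  assumes "0 < eps"
  shows "AE \<omega> in M. \<forall>j<p + q. (\<lambda>n. (\<Sum>i<n. psi (\<lambda>i. quant eps (y i \<omega>)) (\<lambda>i. u i \<omega>) p q i $ j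
    * w (Suc i) \<omega>) / real n) \<longlonglongrightarrow> 0"
proof -
  obtain C where C: "\<And>n. integrable M (\<lambda>\<omega>. (y n \<omega>)\<^sup>2)" "\<And>n. expectation (\<lambda>\<omega>. (y n \<omega>)\<^sup>2) \<le> C"
    using y_second_moment by blast
  have q_adapted: "(\<lambda>\<omega>. quant eps (y i \<omega>)) \<in> borel_measurable (generated_algebra X (past n))" if "i \<le> n" for i n
    by (rule measurable_compose[OF y_adapted[OF that] quant_measurable])
  note meas = generated_subset_measurable[OF q_adapted[OF order_refl]]
    generated_subset_measurable[OF u_adapted[OF order_refl]]
  have "AE \<omega> in M. (quant eps (y n \<omega>))\<^sup>2 \<le> 2 * (y n \<omega>)\<^sup>2 + 2 * (eps / 2)\<^sup>2" for n
  proof (rule AE_I2)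
    fix \<omega>
    define e where "e = quant eps (y n \<omega>) - y n \<omega>"
    have "\<bar>e\<bar> \<le> eps / 2" unfolding e_def by (rule quant_error[OF assms])
    then have "e\<^sup>2 \<le> (eps / 2)\<^sup>2" by (metis abs_ge_zero power2_abs power_mono)
    moreover have "(y n \<omega> + e)\<^sup>2 \<le> 2 * (y n \<omega>)\<^sup>2 + 2 * e\<^sup>2"
      using sum_squares_bound[of "y n \<omega>" e] by (simp add: power2_sum)
    ultimately show "(quant eps (y n \<omega>))\<^sup>2 \<le> 2 * (y n \<omega>)\<^sup>2 + 2 * (eps / 2)\<^sup>2" by (simp add: e_def)
  qed
  note s_mom = second_moment_of_AE_bound[OF meas(1) _ this]
  have s_int: "integrable M (\<lambda>\<omega>. (quant eps (y n \<omega>))\<^sup>2)"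
    and s_le: "expectation (\<lambda>\<omega>. (quant eps (y n \<omega>))\<^sup>2) \<le> 2 * C + 2 * (eps / 2)\<^sup>2" for n
    using s_mom[of n] C[of n] by (simp_all add: prob_space)
  have u_le: "AE \<omega> in M. (u n \<omega>)\<^sup>2 \<le> \<delta>\<^sup>2" for n
    using uniform_AE_bounded[OF u_distr[of n]]
    by eventually_elim (metis abs_ge_zero power2_abs power_mono)
  have u_int: "integrable M (\<lambda>\<omega>. (u n \<omega>)\<^sup>2)" and u_mom: "expectation (\<lambda>\<omega>. (u n \<omega>)\<^sup>2) \<le> \<delta>\<^sup>2" for n
    using second_moment_of_AE_bound[OF meas(2) _ u_le[of n]] by (simp_all add: prob_space)
  have "AE \<omega> in M. (\<lambda>n. (\<Sum>i<n. psi (\<lambda>i. quant eps (y i \<omega>)) (\<lambda>i. u i \<omega>) p q i $ j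
      * w (Suc i) \<omega>) / real n) \<longlonglongrightarrow> 0" if "j < p + q" for j
  proof (cases "j < p")
    case True
    then show ?thesis
      using strong_law_lagged[OF q_adapted s_int s_le, where k = j] that by (simp add: psi_def)
  next
    case False
    then show ?thesis
      using strong_law_lagged[OF u_adapted u_int u_mom, where k = "j - p"] that by (simp add: psi_def)
  qed
  then have "AE \<omega> in M. \<forall>j\<in>{..<p + q}. (\<lambda>n. (\<Sum>i<n. psi (\<lambda>i. quant eps (y i \<omega>)) (\<lambda>i. u i \<omega>) p q i $ j
      * w (Suc i) \<omega>) / real n) \<longlonglongrightarrow> 0"
    by (intro AE_finite_allI) auto
  then show ?thesis by (simp only: Ball_def lessThan_iff)
qed

lemma noise_energy: "AE \<omega> in M. \<forall>\<^sub>F n in sequentially. (\<Sum>i<n. (w (Suc i) \<omega>)\<^sup>2) \<le> 2 * real n"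
proof -
  have "inj (\<lambda>n. Inl (Suc n) :: nat + nat)" by (simp add: inj_on_def)
  from std_normal_energy[OF indep_X this] w_distr show ?thesis by (simp add: X_def)
qed

end

theorem theorem1:
  fixes M :: "'w measure"
    and w u y :: "nat \<Rightarrow> 'w \<Rightarrow> real"
    and a b :: "nat \<Rightarrow> real"
    and p0 q0 pstar qstar :: nat
    and eps \<delta> c c1 c3 \<gamma> \<alpha>1 \<alpha>2 :: real
    and l :: "nat \<Rightarrow> real"
  assumes prob: "prob_space M"
    \<comment> \<open>noise: i.i.d. N(0,1); input (A1): i.i.d. uniform on [-delta,delta]; jointly independent\<close>
    and w_distr: "\<And>n. distributed M lborel (w n) (\<lambda>x. ennreal (std_normal_density x))"
    and \<delta>_pos: "\<delta> > 0"
    and u_distr: "\<And>n. distributed M lborel (u n)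
                     (\<lambda>x. ennreal (indicator {-\<delta>..\<delta>} x / (2 * \<delta>)))"
    and indep: "prob_space.indep_vars M (\<lambda>_. borel)
                  (\<lambda>k. case k of Inl n \<Rightarrow> w n | Inr n \<Rightarrow> u n) UNIV"
    \<comment> \<open>system: y_{n+1} = -a_1 y_n - ... - a_{p0} y_{n-p0+1} + b_1 u_n + ... + b_{q0} u_{n-q0+1} + w_{n+1},
        with y_k = u_k = 0 for k < 0, and y_0 = w_0\<close>
    and y0: "\<And>\<omega>. y 0 \<omega> = w 0 \<omega>"
    and sys: "\<And>n \<omega>. y (Suc n) \<omega> =
                 - (\<Sum>i=1..p0. a i * neg0 (\<lambda>k. y k \<omega>) (int n + 1 - int i))
                 + (\<Sum>j=1..q0. b j * neg0 (\<lambda>k. u k \<omega>) (int n + 1 - int j))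
                 + w (Suc n) \<omega>"
    and q0_pos: "q0 \<ge> 1"
    and a_last: "p0 > 0 \<Longrightarrow> a p0 \<noteq> 0"
    and b_last: "b q0 \<noteq> 0"
    and a_zero: "\<And>i. i > p0 \<Longrightarrow> a i = 0"
    and b_zero: "\<And>j. j > q0 \<Longrightarrow> b j = 0"
    \<comment> \<open>(A2) stability\<close>
    and A2: "\<And>z::complex. cmod z \<le> 1 \<Longrightarrow> 1 + (\<Sum>i=1..p0. complex_of_real (a i) * z ^ i) \<noteq> 0"
    \<comment> \<open>(A3)\<close>
    and c_pos: "c > 0"
    and a_bd: "\<And>i. 1 \<le> i \<Longrightarrow> i \<le> p0 \<Longrightarrow> \<bar>a i\<bar> \<le> c"
    and b_bd: "\<And>j. 1 \<le> j \<Longrightarrow> j \<le> q0 \<Longrightarrow> \<bar>b j\<bar> \<le> c"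
    and eps_pos: "eps > 0"
    and eps_small: "eps < 1 / (2 * (1 + real p0 * c))"
    \<comment> \<open>(A4)\<close>
    and pstar_pos: "pstar > 0" and qstar_pos: "qstar > 0"
    and A4: "p0 \<le> pstar" "q0 \<le> qstar"
    \<comment> \<open>(A5)\<close>
    and c1_pos: "c1 > 0"
    and A5: "\<And>p. p \<le> pstar \<Longrightarrow> AE \<omega> in M. \<forall>\<^sub>F n in sequentially.
               lmin (\<lambda>i. quant eps (y i \<omega>)) (\<lambda>i. u i \<omega>) p qstar n \<ge> c1 * real (n + 1)"
    \<comment> \<open>c3 and gamma\<close>
    and c3_pos: "c3 > 0"
    and c3_bd: "AE \<omega> in M. \<forall>\<^sub>F n in sequentially.
               lmax (\<lambda>i. quant eps (y i \<omega>)) (\<lambda>i. u i \<omega>) p0 qstar n \<le> c3 * real (n + 1)"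
    and \<gamma>_bd: "AE \<omega> in M. \<forall>\<^sub>F n in sequentially. \<forall>p\<le>p0.
               vnorm (theta_tilde a b (\<lambda>i. quant eps (y i \<omega>)) (\<lambda>i. u i \<omega>) p0 qstar p n) \<le> \<gamma>"
    \<comment> \<open>penalty sequence\<close>
    and \<alpha>1_pos: "\<alpha>1 > 0" and \<alpha>2_pos: "0 < \<alpha>2" and \<alpha>2_lt: "\<alpha>2 < 1"
    and l_lower: "\<And>n. (5 * (1 + real pstar * c) * eps + \<alpha>1) * real n \<le> l n"
    and l_upper: "\<And>n. l n \<le> \<alpha>2 / real pstar *
               ((a p0)\<^sup>2 * c1 - 2 * \<gamma> * sqrt (c3 * (1 + real pstar * c) * eps)
                 - 3 * (1 + real pstar * c) * eps) * real n"
  shows "AE \<omega> in M. (\<lambda>n. phat (\<lambda>i. quant eps (y i \<omega>)) (\<lambda>i. u i \<omega>) l pstar qstar n)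
                        \<longlonglongrightarrow> p0"
proof -
  interpret arx_system M w u y a b p0 q0 \<delta>
    using prob w_distr u_distr indep y0 sys A2
    by (intro arx_system.intro arx_system_axioms.intro)
  define K where "K = (1 + real pstar * c) * eps"
  define h where "h = (1 + real p0 * c) * eps / 2"
  have h_pos: "0 < h" using c_pos eps_pos by (simp add: h_def add_pos_nonneg)
  \<comment> \<open>(A3) says (1 + p0 c) eps < 1/2, and h is half of that product.\<close>
  have h_small: "h < 1 / 4"
    using eps_small c_pos by (simp add: h_def field_simps add_pos_nonneg)
  have h_K: "2 * h \<le> K"
    using A4(1) c_pos eps_pos by (simp add: h_def K_def mult_right_mono)
  \<comment> \<open>h^2 < h <= K / 2 < K: smallness of the quantization step turns a bound linear in
    eps into one for squared errors.\<close>
  have "h * h < 1 * h" using h_pos h_small by (intro mult_strict_right_mono) auto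
  then have h_sq: "h\<^sup>2 < K" using h_K h_pos unfolding power2_eq_square by linarith
  \<comment> \<open>Only finitely many orders compete, so the exceptional null sets can be
    merged.\<close>
  have A5': "AE \<omega> in M. \<forall>p\<in>{..pstar}. \<forall>\<^sub>F n in sequentially.
      c1 * real (n + 1) \<le> lmin (\<lambda>i. quant eps (y i \<omega>)) (\<lambda>i. u i \<omega>) p qstar n"
    using A5 by (intro AE_finite_allI) auto
  have noise': "AE \<omega> in M. \<forall>p\<in>{..pstar}. \<forall>j<p + qstar. (\<lambda>n. (\<Sum>i<n.
      psi (\<lambda>i. quant eps (y i \<omega>)) (\<lambda>i. u i \<omega>) p qstar i $ j * w (Suc i) \<omega>) / real n) \<longlonglongrightarrow> 0"
    using psi_noise_average[OF eps_pos] by (intro AE_finite_allI) auto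
  from A5' noise' noise_energy c3_bd \<gamma>_bd show ?thesis
  proof eventually_elim
    case (elim \<omega>)
    \<comment> \<open>From here \<omega> is fixed; the final 2 is the noise energy constant
      C.\<close>
    interpret quantized_path "\<lambda>i. quant eps (y i \<omega>)" "\<lambda>i. u i \<omega>" "\<lambda>i. w i \<omega>"
      "arx_regression a b p0 q0 (\<lambda>i. quant eps (y i \<omega>)) (\<lambda>i. u i \<omega>)" a b l
      p0 pstar qstar c1 c3 \<gamma> \<alpha>1 \<alpha>2 h K 2
    proof
      show "(\<Sum>j<p + qstar. theta_bar a b p qstar $ j *
          psi (\<lambda>i. quant eps (y i \<omega>)) (\<lambda>i. u i \<omega>) p qstar i $ j)
          = arx_regression a b p0 q0 (\<lambda>i. quant eps (y i \<omega>)) (\<lambda>i. u i \<omega>) i" if "p0 \<le> p" for p i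
        using a_zero b_zero that A4(2) by (intro theta_bar_regression) auto
      show "\<forall>\<^sub>F i in sequentially. \<bar>quant eps (y (Suc i) \<omega>)
          - arx_regression a b p0 q0 (\<lambda>i. quant eps (y i \<omega>)) (\<lambda>i. u i \<omega>) i - w (Suc i) \<omega>\<bar> \<le> h"
        unfolding h_def
        by (rule eventually_sequentiallyI[of "max p0 q0"], rule arx_residual_bound[OF sys])
          (use eps_pos a_bd in auto)
    qed (use elim A4 pstar_pos c1_pos c3_pos h_sq \<alpha>1_pos \<alpha>2_pos \<alpha>2_lt l_lower l_upper
        in \<open>auto simp: K_def mult_ac\<close>)
    show ?case by (rule phat_tendsto)
  qed
qed

end
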